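(* Let $\Gamma=(S,R)$ be a finite simple connected graph which is nondegenerate but is not the line graph of any simple graph. Let $H$ be the subgroup of ${\rm GL}(V^\ast)$ generated by the maps $\kappa_s$ ($s\in S$). Then $H$ is isomorphic to the orthogonal group $O(V)=\{\sigma\in {\rm GL}(V)\mid Q(\sigma\alpha)=Q(\alpha)\ \text{for all }\alpha\in V\}$. Moreover, the $H$-orbits on $V^\ast$ are exactly $$\{0\},\qquad \theta\big(Q^{-1}(0)\setminus\{0\}\big),\qquad \theta\big(Q^{-1}(1)\big).$$
   Context: Let $\mathbb{F}_2=\{0,1\}$. Let $V$ be the $\mathbb{F}_2$-vector space with basis $\{\alpha_s\mid s\in S\}$, and let $V^\ast$ be its dual space with dual basis $\{f_s\mid s\in S\}$, so $f_s(\alpha_t)=1$ if $s=t$ and $0$ otherwise. Let $B$ be the bilinear form on $V$ with $B(\alpha_s,\alpha_t)=1$ if $st\in R$ and $0$ otherwise. The graph $\Gamma$ is called nondegenerate if $B$ is nondegenerate, i.e. the only $\alpha\in V$ with $B(\alpha,\beta)=0$ for all $\beta\in V$ is $\alpha=0$. Equivalently, the adjacency matrix of $\Gamma$ over $\mathbb{F}_2$ is invertible. Define $\theta:V\to V^\ast$ by $\theta(\alpha)(\beta)=B(\alpha,\beta)$. For $s\in S$, define $\kappa_s:V^\ast\to V^\ast$ by $\kappa_s f=f+f(\alpha_s)\sum_{st\in R}f_t$. This is the move of the lit-only $\sigma$-game at vertex $s$, where a configuration $f$ has vertex $t$ "on" iff $f(\alpha_t)=1$. Let $Q:V\to\mathbb{F}_2$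 be the unique quadratic form satisfying $Q(\alpha+\beta)=Q(\alpha)+Q(\beta)+B(\alpha,\beta)$ for all $\alpha,\beta\in V$ and $Q(\alpha_s)=1$ for all $s\in S$. The line graph of a graph $G$ has the edges of $G$ as vertices, with two of them adjacent iff they share an endpoint. *)

theory Defs
  imports "HOL-Analysis.Cartesian_Space" "HOL-Library.Z2"
    "HOL-Algebra.Generated_Groups" "HOL-Algebra.Group_Action"
begin

text \<open>A graph is given by its vertex set and its set of edges, the edges being two-element sets
  of vertices.\<close>

definition simple_graph :: "'a set \<Rightarrow> 'a set set \<Rightarrow> bool"
  where "simple_graph W E \<longleftrightarrow> (\<forall>e\<in>E. e \<subseteq> W \<and> card e = 2)"

definition connected_graph :: "'a set \<Rightarrow> 'a set set \<Rightarrow> bool"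
  where "connected_graph W E \<longleftrightarrow>
    W \<noteq> {} \<and> (\<forall>s\<in>W. \<forall>t\<in>W. (s, t) \<in> {(u, v). u \<in> W \<and> v \<in> W \<and> {u, v} \<in> E}\<^sup>*)"

definition graph_iso :: "'a set \<Rightarrow> 'a set set \<Rightarrow> 'b set \<Rightarrow> 'b set set \<Rightarrow> bool"
  where "graph_iso W E W' E' \<longleftrightarrow>
    (\<exists>\<phi>. bij_betw \<phi> W W' \<and> (\<forall>s\<in>W. \<forall>t\<in>W. {s, t} \<in> E \<longleftrightarrow> {\<phi> s, \<phi> t} \<in> E'))"

definition line_graph_edges :: "'a set set \<Rightarrow> 'a set set set"
  where "line_graph_edges E = {{e, f} | e f. e \<in> E \<and> f \<in> E \<and> e \<noteq> f \<and> e \<inter> f \<noteq> {}}"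

text \<open>The root graph is taken with natural numbers as vertices, since one cannot quantify over
  types here.  For finite graphs this is no restriction; see \<open>is_line_graphI\<close> below.\<close>

definition is_line_graph :: "'a set \<Rightarrow> 'a set set \<Rightarrow> bool"
  where "is_line_graph W E \<longleftrightarrow>
    (\<exists>(X :: nat set) F. simple_graph X F \<and> graph_iso W E F (line_graph_edges F))"

lemma line_graph_edges_iff:
  "{e, f} \<in> line_graph_edges E \<longleftrightarrow> e \<in> E \<and> f \<in> E \<and> e \<noteq> f \<and> e \<inter> f \<noteq> {}"
  unfolding line_graph_edges_def by (auto simp: doubleton_eq_iff)

lemma is_line_graphI:
  fixes X :: "'b set"
  assumes fin: "finite W" and F: "simple_graph X F"
    and iso: "graph_iso W E F (line_graph_edges F)"
  shows "is_line_graph W E"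
proof -
  obtain \<phi> where bij: "bij_betw \<phi> W F"
    and adj: "\<And>s t. s \<in> W \<Longrightarrow> t \<in> W \<Longrightarrow> {s, t} \<in> E \<longleftrightarrow> {\<phi> s, \<phi> t} \<in> line_graph_edges F"
    using iso unfolding graph_iso_def by blast
  have finF: "finite F" using bij fin bij_betw_finite by blast
  have "finite (\<Union>F)"
    using finF F unfolding simple_graph_def by (metis card.infinite finite_Union zero_neq_numeral)
  then obtain h :: "'b \<Rightarrow> nat" where h: "inj_on h (\<Union>F)"
    by (metis finite_imp_inj_to_nat_seg)
  let ?F = "(`) h ` F"
  have inj: "inj_on ((`) h) F"
    using h by (meson inj_on_image)
  have "simple_graph (UNIV :: nat set) ?F"
    unfolding simple_graph_def
  proof
    fix e assume "e \<in> ?F"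
    then obtain d where d: "d \<in> F" "e = h ` d" by auto
    have "inj_on h d" using h d(1) by (meson Union_upper inj_on_subset)
    then show "e \<subseteq> UNIV \<and> card e = 2"
      using d F unfolding simple_graph_def by (simp add: card_image)
  qed
  moreover have "bij_betw ((`) h \<circ> \<phi>) W ?F"
    using bij inj by (meson bij_betw_trans inj_on_imp_bij_betw)
  moreover have "{s, t} \<in> E \<longleftrightarrow> {((`) h \<circ> \<phi>) s, ((`) h \<circ> \<phi>) t} \<in> line_graph_edges ?F"
    if st: "s \<in> W" "t \<in> W" for s t
  proof -
    have m: "\<phi> s \<in> F" "\<phi> t \<in> F" using bij st by (auto simp: bij_betw_def)
    have "h ` \<phi> s \<noteq> h ` \<phi> t \<longleftrightarrow> \<phi> s \<noteq> \<phi> t"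
      using inj m by (auto simp: inj_on_def)
    moreover have "h ` \<phi> s \<inter> h ` \<phi> t = h ` (\<phi> s \<inter> \<phi> t)"
      using inj_on_image_Int[OF h, of "\<phi> s" "\<phi> t"] m by (simp add: Union_upper)
    ultimately show ?thesis
      using adj[OF st] m by (simp add: line_graph_edges_iff)
  qed
  ultimately show ?thesis
    unfolding is_line_graph_def graph_iso_def by blast
qed

text \<open>These default rules of \<^typ>\<open>bit\<close> rewrite field operations to bit operations, which blocks
  algebraic simplification.\<close>

declare add_bit_eq_xor [simp del] mult_bit_eq_and [simp del] power_bit_unfold [simp del]

lemma bit_add_self [simp]: "x + x = (0::bit)"
  by (cases x) (simp_all add: add_bit_eq_xor)

definition GL :: "('k::field \<Rightarrow> 'v::ab_group_add \<Rightarrow> 'v) \<Rightarrow> ('v \<Rightarrow> 'v) monoid"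
  where "GL scl =
    \<lparr>carrier = {T. Vector_Spaces.linear scl scl T \<and> bij T}, mult = (\<circ>), one = id\<rparr>"

lemma group_GL:
  assumes "vector_space scl"
  shows "group (GL scl)"
proof (rule groupI)
  interpret vector_space scl by fact
  interpret vector_space_pair scl scl ..
  show "\<one>\<^bsub>GL scl\<^esub> \<in> carrier (GL scl)"
    by (simp add: GL_def linear_id)
  fix x y
  assume x: "x \<in> carrier (GL scl)"
  show "\<exists>y\<in>carrier (GL scl). y \<otimes>\<^bsub>GL scl\<^esub> x = \<one>\<^bsub>GL scl\<^esub>"
  proof
    have l: "Vector_Spaces.linear scl scl x" and b: "bij x" using x by (auto simp: GL_def)
    interpret x: Vector_Spaces.linear scl scl x by fact
    have "Vector_Spaces.linear scl scl (inv_into UNIV x)"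
      unfolding Vector_Spaces.linear_iff
    proof (intro conjI allI vector_space_axioms)
      fix u v c
      show "inv_into UNIV x (u + v) = inv_into UNIV x u + inv_into UNIV x v"
        using b by (metis bij_inv_eq_iff x.add)
      show "inv_into UNIV x (scl c u) = scl c (inv_into UNIV x u)"
        using b by (metis bij_inv_eq_iff x.scale)
    qed
    then show "inv_into UNIV x \<in> carrier (GL scl)"
      using b by (simp add: GL_def bij_imp_bij_inv)
    show "inv_into UNIV x \<otimes>\<^bsub>GL scl\<^esub> x = \<one>\<^bsub>GL scl\<^esub>"
      using b by (simp add: GL_def bij_is_inj)
  qed
  assume "y \<in> carrier (GL scl)"
  then show "x \<otimes>\<^bsub>GL scl\<^esub> y \<in> carrier (GL scl)"
    using x by (auto simp: GL_def intro: Vector_Spaces.linear_compose bij_comp)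
qed (auto simp: GL_def comp_assoc)

text \<open>The vertex set is the
  finite type \<^typ>\<open>'s\<close>, so that V is \<^typ>\<open>bit^'s\<close>.\<close>

abbreviation simple_root :: "'s::finite \<Rightarrow> bit^'s"
  where "simple_root s \<equiv> axis s 1"

typedef (overloaded) ('s::finite) dual = "{f :: bit^'s \<Rightarrow> bit. Vector_Spaces.linear (*s) (*) f}"
  morphisms dual_apply Abs_dual
  by (intro exI[of _ "\<lambda>v. 0"])
    (simp add: Vector_Spaces.linear_iff vec.vector_space_axioms vector_space_over_itself.vector_space_axioms)

setup_lifting type_definition_dual

lemma linear_functional_iff:
  fixes f :: "bit^'s::finite \<Rightarrow> bit"
  shows "Vector_Spaces.linear (*s) (*) f \<longleftrightarrow>
    (\<forall>u v. f (u + v) = f u + f v) \<and> (\<forall>c v. f (c *s v) = c * f v)"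
  by (simp add: Vector_Spaces.linear_iff vec.vector_space_axioms vector_space_over_itself.vector_space_axioms)

instantiation dual :: (finite) ab_group_add
begin

lift_definition zero_dual :: "'a dual" is "\<lambda>v. 0"
  by (simp add: linear_functional_iff)

lift_definition plus_dual :: "'a dual \<Rightarrow> 'a dual \<Rightarrow> 'a dual" is "\<lambda>f g v. f v + g v"
  by (simp add: linear_functional_iff algebra_simps)

lift_definition minus_dual :: "'a dual \<Rightarrow> 'a dual \<Rightarrow> 'a dual" is "\<lambda>f g v. f v - g v"
  by (simp only: linear_functional_iff) (simp add: algebra_simps)

lift_definition uminus_dual :: "'a dual \<Rightarrow> 'a dual" is "\<lambda>f v. - f v"
  by (simp only: linear_functional_iff) (simp add: algebra_simps)

instance
  by standard (transfer; simp add: algebra_simps)+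

end

lift_definition dual_scale :: "bit \<Rightarrow> 's::finite dual \<Rightarrow> 's dual" is "\<lambda>c f v. c * f v"
  by (simp add: linear_functional_iff algebra_simps)

lift_definition dual_basis :: "'s::finite \<Rightarrow> 's dual" is "\<lambda>s v. v $ s"
  by (simp add: linear_functional_iff)

lemma dual_basis_simple_root: "dual_apply (dual_basis s) (simple_root t) = (if s = t then 1 else 0)"
  by (auto simp: dual_basis.rep_eq axis_def)

lemma vector_space_dual: "vector_space dual_scale"
  by standard (transfer; simp add: algebra_simps)+

definition bform :: "'s::finite set set \<Rightarrow> bit^'s \<Rightarrow> bit^'s \<Rightarrow> bit"
  where "bform R \<alpha> \<beta> = (\<Sum>s\<in>UNIV. \<Sum>t\<in>UNIV. \<alpha> $ s * \<beta> $ t * (if {s, t} \<in> R then 1 else 0))"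

lemma bform_simple_root: "bform R (simple_root s) (simple_root t) = (if {s, t} \<in> R then 1 else 0)"
proof -
  have "bform R (simple_root s) (simple_root t) =
      (\<Sum>v\<in>UNIV. simple_root t $ v * (if {s, v} \<in> R then 1 else 0))"
    by (simp add: bform_def axis_def mult.assoc flip: sum_distrib_left)
      (simp add: if_distrib[of "\<lambda>x. x * _"] cong: if_cong)
  also have "\<dots> = (if {s, t} \<in> R then 1 else 0)"
    by (simp add: axis_def if_distrib[of "\<lambda>x. x * _"] cong: if_cong)
  finally show ?thesis .
qed

lemma bform_add_left: "bform R (u + v) w = bform R u w + bform R v w"
  by (simp add: bform_def algebra_simps sum.distrib)

lemma bform_add_right: "bform R w (u + v) = bform R w u + bform R w v"
  by (simp add: bform_def algebra_simps sum.distrib)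

lemma bform_scale_left: "bform R (c *s u) w = c * bform R u w"
  by (simp add: bform_def sum_distrib_left mult.assoc)

lemma bform_scale_right: "bform R w (c *s u) = c * bform R w u"
  by (simp add: bform_def sum_distrib_left mult_ac)

definition nondegenerate_graph :: "'s::finite set set \<Rightarrow> bool"
  where "nondegenerate_graph R \<longleftrightarrow> (\<forall>\<alpha>. (\<forall>\<beta>. bform R \<alpha> \<beta> = 0) \<longrightarrow> \<alpha> = 0)"

definition is_qform :: "'s::finite set set \<Rightarrow> (bit^'s \<Rightarrow> bit) \<Rightarrow> bool"
  where "is_qform R q \<longleftrightarrow>
    (\<forall>c \<alpha>. q (c *s \<alpha>) = c\<^sup>2 * q \<alpha>) \<and>
    (\<forall>\<alpha> \<beta>. q (\<alpha> + \<beta>) = q \<alpha> + q \<beta> + bform R \<alpha> \<beta>) \<and>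
    (\<forall>s. q (simple_root s) = 1)"

definition qform :: "'s::finite set set \<Rightarrow> bit^'s \<Rightarrow> bit"
  where "qform R = (THE q. is_qform R q)"

lemma is_qform_unique:
  assumes "is_qform R q" "is_qform R q'"
  shows "q = q'"
proof
  fix \<alpha>
  have z: "q 0 = 0" "q' 0 = 0"
    using assms unfolding is_qform_def by (metis mult_zero_left vector_smult_lzero zero_power2)+
  have *: "q (\<Sum>s\<in>A. (\<alpha> $ s) *s simple_root s) = q' (\<Sum>s\<in>A. (\<alpha> $ s) *s simple_root s)" for A
  proof (induction A rule: infinite_finite_induct)
    case (insert x A)
    then show ?case using assms unfolding is_qform_def by simp
  qed (use z in simp_all)
  have "\<alpha> = (\<Sum>s\<in>UNIV. (\<alpha> $ s) *s simple_root s)"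
    by (simp add: basis_expansion)
  then show "q \<alpha> = q' \<alpha>" using *[of UNIV] by simp
qed

lemma ex1_is_qform:
  fixes R :: "'s::finite set set"
  assumes "simple_graph UNIV R"
  shows "\<exists>!q. is_qform R q"
proof -
  define q :: "bit^'s \<Rightarrow> bit"
    where "q v = (\<Sum>s\<in>UNIV. v $ s) + (\<Sum>e\<in>R. \<Prod>s\<in>e. v $ s)" for v
  have pair: "\<exists>a b. a \<noteq> b \<and> e = {a, b}" if "e \<in> R" for e
    using assms that unfolding simple_graph_def card_2_iff by metis
  have B_edges: "bform R u v = (\<Sum>e\<in>R. \<Sum>(s, t) | {s, t} = e. u $ s * v $ t)" for u v
  proof -
    have "bform R u v = (\<Sum>(s, t)\<in>UNIV. if {s, t} \<in> R then u $ s * v $ t else 0)"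
      unfolding bform_def sum.cartesian_product UNIV_Times_UNIV by (intro sum.cong refl) auto
    also have "\<dots> = (\<Sum>p\<in>UNIV. if (case p of (s, t) \<Rightarrow> {s, t} \<in> R) then u $ fst p * v $ snd p else 0)"
      by (intro sum.cong refl) auto
    also have "\<dots> = (\<Sum>p | (case p of (s, t) \<Rightarrow> {s, t} \<in> R). u $ fst p * v $ snd p)"
      by (subst sum.inter_filter[symmetric]) auto
    also have "\<dots> = (\<Sum>e\<in>R. \<Sum>p | p \<in> {p. case p of (s, t) \<Rightarrow> {s, t} \<in> R} \<and>
        (case p of (s, t) \<Rightarrow> {s, t}) = e. u $ fst p * v $ snd p)"
      by (rule sum.group[symmetric]) auto
    also have "\<dots> = (\<Sum>e\<in>R. \<Sum>(s, t) | {s, t} = e. u $ s * v $ t)"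
      by (intro sum.cong refl) auto
    finally show ?thesis .
  qed
  have edge: "(\<Prod>s\<in>e. (u + v) $ s) =
      (\<Prod>s\<in>e. u $ s) + (\<Prod>s\<in>e. v $ s) + (\<Sum>(s, t) | {s, t} = e. u $ s * v $ t)"
    if e: "e \<in> R" for e and u v :: "bit^'s"
  proof -
    obtain a b where ab: "a \<noteq> b" "e = {a, b}" using pair[OF e] by blast
    have "{(s, t). {s, t} = e} = {(a, b), (b, a)}"
      using ab by (auto simp: doubleton_eq_iff)
    then show ?thesis using ab by (simp add: algebra_simps)
  qed
  have "is_qform R q"
    unfolding is_qform_def
  proof (intro conjI allI)
    fix c :: bit and \<alpha> \<beta> :: "bit^'s" and s :: 's
    have "q 0 = 0"
    proof -
      have "(\<Prod>s\<in>e. (0 :: bit^'s) $ s) = 0" if "e \<in> R" for e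
        using pair[OF that] by auto
      then have "(\<Sum>e\<in>R. \<Prod>s\<in>e. (0 :: bit^'s) $ s) = 0" by (rule sum.neutral[OF ballI])
      then show ?thesis unfolding q_def by simp
    qed
    then show "q (c *s \<alpha>) = c\<^sup>2 * q \<alpha>" by (cases c) auto
    show "q (\<alpha> + \<beta>) = q \<alpha> + q \<beta> + bform R \<alpha> \<beta>"
      by (simp add: q_def B_edges edge sum.distrib del: vector_add_component)
        (simp add: sum.distrib ac_simps)
    have "(\<Prod>t\<in>e. simple_root s $ t) = 0" if "e \<in> R" for e
      using pair[OF that] by (auto simp: axis_def)
    then have "(\<Sum>e\<in>R. \<Prod>t\<in>e. simple_root s $ t) = 0" by (rule sum.neutral[OF ballI])
    then have "q (simple_root s) = (\<Sum>t\<in>UNIV. simple_root s $ t)" by (simp add: q_def)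
    also have "\<dots> = 1" by (simp add: axis_def)
    finally show "q (simple_root s) = 1" .
  qed
  then show ?thesis using is_qform_unique by blast
qed

lemma is_qform_qform:
  assumes "simple_graph UNIV R"
  shows "is_qform R (qform R)"
  unfolding qform_def using ex1_is_qform[OF assms] by (rule theI')

lift_definition \<theta> :: "'s::finite set set \<Rightarrow> bit^'s \<Rightarrow> 's dual" is "\<lambda>R \<alpha> \<beta>. bform R \<alpha> \<beta>"
  by (simp add: linear_functional_iff bform_add_right bform_scale_right)

definition \<kappa> :: "'s::finite set set \<Rightarrow> 's \<Rightarrow> 's dual \<Rightarrow> 's dual"
  where "\<kappa> R s f =
    f + dual_scale (dual_apply f (simple_root s)) (\<Sum>t | {s, t} \<in> R. dual_basis t)"

definition flipping_group :: "'s::finite set set \<Rightarrow> ('s dual \<Rightarrow> 's dual) monoid"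
  where "flipping_group R = subgroup_generated (GL dual_scale) (range (\<kappa> R))"

definition orthogonal_group :: "'s::finite set set \<Rightarrow> (bit^'s \<Rightarrow> bit^'s) monoid"
  where "orthogonal_group R =
    GL (*s) \<lparr>carrier := {\<sigma> \<in> carrier (GL (*s)). \<forall>\<alpha>. qform R (\<sigma> \<alpha>) = qform R \<alpha>}\<rparr>"

text \<open>\<^const>\<open>subgroup_generated\<close> intersects the generating set with the carrier; nothing
  is lost, as every \<open>\<kappa> R s\<close> is an invertible linear map.\<close>

lemma kappa_in_GL:
  assumes "simple_graph UNIV R"
  shows "\<kappa> R s \<in> carrier (GL dual_scale)"
proof -
  let ?g = "\<Sum>t | {s, t} \<in> R. dual_basis t"
  interpret vector_space "dual_scale :: bit \<Rightarrow> 'a dual \<Rightarrow> 'a dual" by (rule vector_space_dual)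
  have app_sum: "dual_apply (\<Sum>t\<in>A. dual_basis t) v = (\<Sum>t\<in>A. v $ t)" for A and v :: "bit^'a"
    by (induction A rule: infinite_finite_induct)
      (simp_all add: zero_dual.rep_eq plus_dual.rep_eq dual_basis.rep_eq)
  have "{s, s} \<notin> R" using assms by (auto simp: simple_graph_def)
  then have g: "dual_apply ?g (simple_root s) = 0"
    unfolding app_sum by (intro sum.neutral) (auto simp: axis_def)
  have "Vector_Spaces.linear dual_scale dual_scale (\<kappa> R s)"
    unfolding Vector_Spaces.linear_iff
    by (simp add: vector_space_axioms \<kappa>_def plus_dual.rep_eq dual_scale.rep_eq scale_left_distrib scale_right_distrib add_ac)
  moreover have "\<kappa> R s (\<kappa> R s f) = f" for f
  proof -
    have "h + h = 0" for h :: "'a dual" by transfer simp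
    then show ?thesis
      by (simp add: \<kappa>_def plus_dual.rep_eq dual_scale.rep_eq g add.assoc)
  qed
  then have "bij (\<kappa> R s)" by (metis involuntory_imp_bij)
  ultimately show ?thesis by (simp add: GL_def)
qed

end

theory Submission
  imports Defs
begin

text \<open>Let \<open>D\<close> be the set of roots: the closure of the simple roots under adding two nonorthogonal
  elements. Call \<open>P\<close> a clique if all sums \<open>p + q\<close> of distinct elements of \<open>P\<close> are roots.
  A root \<open>d\<close> splits a clique of maximum size according to \<open>B d\<close>. If both parts have at least
  three elements, \<open>D\<close> contains an \<open>E\<^sub>6\<close> configuration; otherwise all roots turn out to be
  differences of elements of \<open>P\<close>, which exhibits the graph as the line graph of a graph on \<open>P\<close>.
  An \<open>E\<^sub>6\<close> configuration spans a six-dimensional space all of whose vectors with \<open>Q = 1\<close> are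
  roots, and this property propagates to larger and larger subspaces, so that
  \<open>D = {v. Q v = 1}\<close>. The transvections in the simple roots then generate all orthogonal
  transvections, hence the orthogonal group, which is transitive on the nonzero singular
  vectors and on the nonsingular ones. Finally \<open>\<theta>\<close> conjugates these transvections to the
  moves \<open>\<kappa>\<close>.\<close>

section \<open>Quadratic spaces over the field of two elements\<close>

text \<open>A clique is modelled on the vectors e_i of type A, whose differences e_i - e_j are
  roots; an edge of the graph sought on P plays the part of such a difference, read modulo 2. The
  obstruction to this picture is type E_6. Its reduction modulo 2 is the six-dimensional quadratic
  space of minus type, and the 36 pairs of opposite roots account for all 36 vectors with
  \<open>Q = 1\<close>. This coincidence is what lets a finite configuration control a whole
  subspace. The difficulty in growing that subspace is that adjoining one root at a time passes
  through odd dimensions, where an alternating form is degenerate: a vector in the radical is never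
  a sum of two nonorthogonal vectors of the subspace, so it has to be exempted and recovered one
  step later.\<close>

lemma bit_add_left_self [simp]: "x + (x + y) = (y::bit)"
  by (simp flip: add.assoc)

text \<open>Over the field with two elements these are exactly the linear subspaces, so the abstract
  development needs no scalar multiplication.\<close>

definition additive_subgroup :: "'v::ab_group_add set \<Rightarrow> bool"
  where "additive_subgroup M \<longleftrightarrow> 0 \<in> M \<and> (\<forall>x\<in>M. \<forall>y\<in>M. x + y \<in> M)"

locale quadratic_space =
  fixes B :: "'v::ab_group_add \<Rightarrow> 'v \<Rightarrow> bit" and Q :: "'v \<Rightarrow> bit"
  assumes finite_space: "finite (UNIV :: 'v set)"
    and add_self [simp]: "x + x = (0::'v)"
    and B_add_left: "B (x + y) z = B x z + B y z"
    and Q_add: "Q (x + y) = Q x + Q y + B x y"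
    and nondegenerate: "(\<And>y. B x y = 0) \<Longrightarrow> x = 0"
begin

lemma finite_subset_space [simp]: "finite (A :: 'v set)"
  using finite_space by (rule rev_finite_subset) simp

lemma ex_greatest_card:
  assumes "P k"
  shows "\<exists>x. P x \<and> (\<forall>y. P y \<longrightarrow> card (f y :: 'v set) \<le> card (f x))"
proof (rule ex_has_greatest_nat[of P k "\<lambda>x. card (f x)", OF assms])
  show "\<forall>y. P y \<longrightarrow> card (f y) < Suc (card (UNIV :: 'v set))"
    by (simp add: card_mono less_Suc_eq_le)
qed

lemma add_left_self [simp]: "x + (x + y) = (y::'v)"
  by (simp flip: add.assoc)

lemma add_eq_0_iff_eq: "x + y = 0 \<longleftrightarrow> x = (y::'v)"
  by (metis add_left_self add.right_neutral add_self)

lemma B_0_left [simp]: "B 0 y = 0"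
  using B_add_left[of 0 0 y] by simp

lemma Q_0 [simp]: "Q 0 = 0"
  using Q_add[of 0 0] by simp

lemma B_self [simp]: "B x x = 0"
  using Q_add[of x x] by simp

lemma B_sym: "B x y = B y x"
  using Q_add[of x y] Q_add[of y x] by (simp add: add.commute)

lemma B_add_right: "B x (y + z) = B x y + B x z"
  by (metis B_add_left B_sym)

lemma B_0_right [simp]: "B x 0 = 0"
  by (metis B_0_left B_sym)

lemmas form_simps = B_add_left B_add_right Q_add

lemma exists_B_eq_1: "x \<noteq> 0 \<Longrightarrow> \<exists>y. B x y = 1"
  using nondegenerate[of x] by (metis bit_not_zero_iff)

section \<open>Orthogonal complements, counted by character sums\<close>

text \<open>The summand is the sign character of \<open>g\<close>. Translation by an element
  \<open>z\<close> with \<open>g z = 1\<close> permutes \<open>G\<close> and flips every sign, so a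
  nontrivial sum equals its own negative.\<close>

lemma sum_character:
  fixes G :: "'v set"
  assumes "additive_subgroup G" and add: "\<And>x y. g (x + y) = g x + (g y :: bit)"
  shows "(\<Sum>x\<in>G. if g x = 0 then 1 else - 1 :: int) =
    (if \<forall>x\<in>G. g x = 0 then int (card G) else 0)"
proof (cases "\<forall>x\<in>G. g x = 0")
  case False
  then obtain z where z: "z \<in> G" "g z = 1" by (metis bit_not_zero_iff)
  let ?S = "\<Sum>x\<in>G. if g x = 0 then 1 else - 1 :: int"
  have "bij_betw (\<lambda>x. z + x) G G"
    using assms(1) z(1) unfolding additive_subgroup_def
    by (intro bij_betwI[where g = "\<lambda>x. z + x"]) auto
  then have "?S = (\<Sum>x\<in>G. if g (z + x) = 0 then 1 else - 1)"
    by (rule sum.reindex_bij_betw[symmetric])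
  also have "\<dots> = (\<Sum>x\<in>G. - (if g x = 0 then 1 else - 1))"
    by (intro sum.cong refl) (auto simp: add z(2) add_eq_0_iff)
  also have "\<dots> = - ?S" by (simp add: sum_negf)
  finally show ?thesis using False by auto
qed simp

text \<open>Both sides evaluate the sum of the signs of \<open>B u k\<close> over all pairs. Summing
  over \<open>u\<close> first leaves only \<open>k = 0\<close>; summing over \<open>k\<close> first
  leaves only the \<open>u\<close> orthogonal to \<open>I\<close>. This takes the place of a
  dimension formula.\<close>

lemma card_perp:
  fixes U I :: "'v set"
  assumes U: "additive_subgroup U" and I: "additive_subgroup I"
    and nondeg: "\<And>k. k \<in> I \<Longrightarrow> \<forall>u\<in>U. B u k = 0 \<Longrightarrow> k = 0"
  shows "card I * card {u \<in> U. \<forall>k\<in>I. B u k = 0} = card U"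
proof -
  let ?f = "\<lambda>u k. if B u k = 0 then 1 else - 1 :: int"
  have "0 \<in> I" using I by (simp add: additive_subgroup_def)
  have "(\<Sum>k\<in>I. \<Sum>u\<in>U. ?f u k) = (\<Sum>k\<in>I. if k = 0 then int (card U) else 0)"
  proof (intro sum.cong refl)
    fix k assume "k \<in> I"
    then show "(\<Sum>u\<in>U. ?f u k) = (if k = 0 then int (card U) else 0)"
      using nondeg[of k] sum_character[OF U, of "\<lambda>u. B u k"] by (auto simp: B_add_left)
  qed
  also have "\<dots> = int (card U)" using \<open>0 \<in> I\<close> by simp
  finally have "int (card U) = (\<Sum>u\<in>U. \<Sum>k\<in>I. ?f u k)"
    by (subst sum.swap) simp
  also have "\<dots> = (\<Sum>u\<in>U. if \<forall>k\<in>I. B u k = 0 then int (card I) else 0)"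
    by (intro sum.cong refl sum_character[OF I] B_add_right)
  also have "\<dots> = (\<Sum>u | u \<in> U \<and> (\<forall>k\<in>I. B u k = 0). int (card I))"
    by (rule sum.inter_filter[symmetric]) simp
  finally have "int (card U) = int (card I * card {u \<in> U. \<forall>k\<in>I. B u k = 0})"
    by simp
  then show ?thesis by linarith
qed

lemma additive_subgroup_adjoin:
  fixes M :: "'v set"
  assumes "additive_subgroup M"
  shows "additive_subgroup (M \<union> (+) d ` M)"
proof -
  have M: "0 \<in> M" "\<And>x y. x \<in> M \<Longrightarrow> y \<in> M \<Longrightarrow> x + y \<in> M"
    using assms by (auto simp: additive_subgroup_def)
  have e: "(d + x) + (d + y) = x + y" "x + (d + y) = d + (x + y)" "(d + y) + x = d + (y + x)" for x y
    by (simp_all add: ac_simps)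
  show ?thesis
    unfolding additive_subgroup_def using M by (auto simp: e)
qed

lemma card_adjoin:
  fixes M :: "'v set"
  assumes "additive_subgroup M" "d \<notin> M"
  shows "card (M \<union> (+) d ` M) = 2 * card M"
proof -
  have "M \<inter> (+) d ` M = {}"
  proof (rule ccontr)
    assume "M \<inter> (+) d ` M \<noteq> {}"
    then obtain y where "y \<in> M" "d + y \<in> M" by auto
    then have "y + (d + y) \<in> M" using assms(1) unfolding additive_subgroup_def by blast
    then show False using assms(2) by (simp add: ac_simps)
  qed
  then show ?thesis by (simp add: card_Un_disjoint card_image)
qed

text \<open>Adjoining \<open>x\<close> doubles \<open>F\<close> and therefore halves its orthogonal
  complement; any vector lost in the process serves as \<open>z\<close>.\<close>

lemma exists_separating:
  fixes F :: "'v set"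
  assumes F: "additive_subgroup F" and x: "x \<notin> F"
  obtains z where "\<And>f. f \<in> F \<Longrightarrow> B z f = 0" "B z x = 1"
proof -
  have U: "additive_subgroup (UNIV :: 'v set)" by (simp add: additive_subgroup_def)
  have nd: "k = 0" if "\<forall>u\<in>UNIV. B u k = 0" for k
    using that by (metis UNIV_I B_sym nondegenerate)
  let ?F = "F \<union> (+) x ` F"
  let ?P = "\<lambda>F. {u \<in> UNIV. \<forall>k\<in>F. B u k = 0}"
  have "card F * card (?P F) = 2 * card F * card (?P ?F)"
    using card_perp[OF U F nd] card_perp[OF U additive_subgroup_adjoin[OF F] nd, of x]
      card_adjoin[OF F x] by simp
  moreover have "0 < card F" using F by (auto simp: card_gt_0_iff additive_subgroup_def)
  ultimately have "card (?P F) = 2 * card (?P ?F)" by auto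
  moreover have "0 < card (?P ?F)" by (auto simp: card_gt_0_iff intro!: exI[of _ 0])
  ultimately have "card (?P F) > card (?P ?F)" by linarith
  then have "\<not> ?P F \<subseteq> ?P ?F" using card_mono[OF finite_subset_space, of "?P F" "?P ?F"] by linarith
  then obtain z where "z \<in> ?P F" "z \<notin> ?P ?F" by (meson subsetI)
  then have z: "\<forall>k\<in>F. B z k = 0" and "\<exists>k\<in>F. B z (x + k) \<noteq> 0" by blast+
  then have "B z x \<noteq> 0" by (metis B_add_right add.right_neutral)
  then show ?thesis using that[of z] z by simp
qed

section \<open>Transvections and their action on singular vectors\<close>

definition transvection :: "'v \<Rightarrow> 'v \<Rightarrow> 'v"
  where "transvection x v = (if B x v = 1 then v + x else v)"

lemma transvection_add: "transvection x (u + v) = transvection x u + transvection x v"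
  by (cases "B x u"; cases "B x v") (simp_all add: transvection_def form_simps ac_simps)

lemma B_transvection_self: "B x (transvection x v) = B x v"
  by (simp add: transvection_def form_simps)

lemma transvection_idem [simp]: "transvection x (transvection x v) = v"
  unfolding transvection_def[of x "transvection x v"] B_transvection_self
  by (simp add: transvection_def ac_simps)

lemma Q_transvection: "Q x = 1 \<Longrightarrow> Q (transvection x v) = Q v"
  by (simp add: transvection_def form_simps B_sym)

text \<open>Here \<open>x + y\<close> is the image of \<open>y\<close> under
  \<open>transvection x\<close>, so this is the usual conjugation rule for an involution.\<close>

lemma transvection_transvection:
  assumes "B x y = 1"
  shows "transvection (x + y) = transvection x \<circ> transvection y \<circ> transvection x"
proof
  fix v
  show "transvection (x + y) v = (transvection x \<circ> transvection y \<circ> transvection x) v"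
    using assms by (cases "B x v"; cases "B y v")
      (simp_all add: transvection_def form_simps B_sym ac_simps)
qed

text \<open>Products of generators alone already form a group, since every transvection is an
  involution.\<close>

inductive_set transvection_group :: "'v set \<Rightarrow> ('v \<Rightarrow> 'v) set" for X
  where id: "id \<in> transvection_group X"
  | step: "x \<in> X \<Longrightarrow> w \<in> transvection_group X \<Longrightarrow> transvection x \<circ> w \<in> transvection_group X"

lemma transvection_group_gen: "x \<in> X \<Longrightarrow> transvection x \<in> transvection_group X"
  using transvection_group.step[OF _ transvection_group.id] by simp

lemma transvection_group_comp:
  assumes "v \<in> transvection_group X" "w \<in> transvection_group X"
  shows "v \<circ> w \<in> transvection_group X"
  using assms by induction (auto intro: transvection_group.step simp: comp_assoc)

lemma transvection_group_inverse:
  assumes "w \<in> transvection_group X"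
  shows "\<exists>v\<in>transvection_group X. v \<circ> w = id \<and> w \<circ> v = id"
  using assms
proof induction
  case id
  show ?case using transvection_group.id by (intro bexI[of _ id]) simp_all
next
  case (step x w)
  then obtain v where v: "v \<in> transvection_group X" "v \<circ> w = id" "w \<circ> v = id" by blast
  have "transvection x \<circ> transvection x = id" by auto
  then have "(v \<circ> transvection x) \<circ> (transvection x \<circ> w) = id"
    "(transvection x \<circ> w) \<circ> (v \<circ> transvection x) = id"
    using v(2,3) by (metis comp_assoc comp_id)+
  then show ?case using v(1) step(1) transvection_group_comp transvection_group_gen by blast
qed

lemma transvection_group_subset:
  assumes "\<And>x. x \<in> X \<Longrightarrow> transvection x \<in> transvection_group Y"
  shows "transvection_group X \<subseteq> transvection_group Y"
proof
  fix w assume "w \<in> transvection_group X"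
  then show "w \<in> transvection_group Y"
    using assms by induction (auto intro: transvection_group.id transvection_group_comp)
qed

lemma transvection_group_bij: "w \<in> transvection_group X \<Longrightarrow> bij w"
  using transvection_group_inverse by (metis o_bij)

lemma transvection_group_add: "w \<in> transvection_group X \<Longrightarrow> w (u + v) = w u + w v"
  by (induction rule: transvection_group.induct) (simp_all add: transvection_add)

lemma transvection_group_Q:
  "w \<in> transvection_group X \<Longrightarrow> (\<And>x. x \<in> X \<Longrightarrow> Q x = 1) \<Longrightarrow> Q (w v) = Q v"
  by (induction rule: transvection_group.induct) (simp_all add: Q_transvection)

text \<open>A vector space is not the union of two proper subspaces, here the complements of
  \<open>x\<close> and \<open>y\<close>.\<close>

lemma exists_common_nonorthogonal:
  assumes "x \<noteq> 0" "y \<noteq> 0"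
  obtains z where "B x z = 1" "B y z = 1"
proof -
  obtain p q where p: "B x p = 1" and q: "B y q = 1"
    using assms exists_B_eq_1 by metis
  consider "B y p = 1" | "B x q = 1" | "B y p = 0" "B x q = 0" by (metis bit_not_zero_iff)
  then show ?thesis
    using that[of p] that[of q] that[of "p + q"] p q by cases (simp_all add: B_add_right)
qed

text \<open>If \<open>B x y = 1\<close>, then \<open>x + y\<close> is nonsingular and its
  transvection exchanges \<open>x\<close> and \<open>y\<close>. Orthogonal vectors are joined
  through a singular vector nonorthogonal to both.\<close>

lemma singular_transitive:
  assumes "Q x = 0" "Q y = 0" "x \<noteq> 0" "y \<noteq> 0"
  shows "\<exists>w\<in>transvection_group {v. Q v = 1}. w x = y"
proof -
  have step: "\<exists>w\<in>transvection_group {v. Q v = 1}. w x = y"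
    if "Q x = 0" "Q y = 0" "B x y = 1" for x y
  proof
    show "transvection (x + y) \<in> transvection_group {v. Q v = 1}"
      using that by (intro transvection_group_gen) (simp add: Q_add)
    show "transvection (x + y) x = y"
      using that by (simp add: transvection_def form_simps B_sym)
  qed
  show ?thesis
  proof (cases "B x y = 1")
    case True
    then show ?thesis using step assms by blast
  next
    case False
    then have xy: "B x y = 0" by simp
    obtain z0 where z0: "B x z0 = 1" "B y z0 = 1"
      using exists_common_nonorthogonal assms by metis
    \<comment> \<open>Adding \<open>x\<close> changes \<open>Q z0\<close> by
      \<open>Q x + B z0 x = 1\<close> and, as \<open>x\<close> is orthogonal to both
      \<open>x\<close> and \<open>y\<close>, leaves the products with them unchanged.\<close>
    define z where "z = (if Q z0 = 1 then z0 + x else z0)"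
    have z: "Q z = 0" "B x z = 1" "B z y = 1"
      using z0 xy assms by (auto simp: z_def form_simps B_sym)
    obtain w1 w2 where "w1 \<in> transvection_group {v. Q v = 1}" "w1 x = z"
      "w2 \<in> transvection_group {v. Q v = 1}" "w2 z = y"
      using step[OF assms(1) z(1,2)] step[OF z(1) assms(2) z(3)] by blast
    then show ?thesis
      by (intro bexI[of _ "w2 \<circ> w1"]) (auto intro: transvection_group_comp)
  qed
qed

subsection \<open>Generation of the orthogonal group by transvections\<close>

lemma isometry_B:
  assumes "\<And>u v. \<tau> (u + v) = \<tau> u + \<tau> v" "\<And>v. Q (\<tau> v) = Q v"
  shows "B (\<tau> u) (\<tau> v) = B u v"
  using Q_add[of "\<tau> u" "\<tau> v"] Q_add[of u v] assms by (metis add_left_imp_eq)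

lemma transvection_fix: "B y f = 0 \<Longrightarrow> transvection y f = f"
  by (simp add: transvection_def)

text \<open>For \<open>Q a = 1\<close>, exactly one of \<open>y\<close> and \<open>y + a\<close> has \<open>Q\<close>-value 1 whenever \<open>y\<close> is
  orthogonal to \<open>a\<close>. Hence every symplectic transvection of \<open>a\<^sup>\<bottom> / a\<close> lifts to an
  orthogonal one, and the usual generation argument for the symplectic group applies.\<close>

lemma enlarge_fixed_space:
  assumes add: "\<And>u v. \<tau> (u + v) = \<tau> u + \<tau> v" and Q: "\<And>v. Q (\<tau> v) = Q v"
    and a: "Q a = 1" "\<tau> a = a" and x: "B a x = 0" "\<tau> x \<noteq> x"
  obtains w where "w \<in> transvection_group {v. Q v = 1}" "w (\<tau> x) = x"
    "\<And>f. B a f = 0 \<Longrightarrow> \<tau> f = f \<Longrightarrow> w f = f"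
proof -
  let ?W = "transvection_group {v. Q v = 1}"
  have B: "B (\<tau> u) (\<tau> v) = B u v" for u v using isometry_B add Q by blast
  have ax': "B a (\<tau> x) = 0" using B[of a x] a x by simp
  have Bf: "B (\<tau> x) f = B x f" if "\<tau> f = f" for f using B[of x f] that by simp
  show ?thesis
  proof (cases "B x (\<tau> x) = 1")
    case True
    show ?thesis
    proof (rule that[of "transvection (x + \<tau> x)"])
      show "transvection (x + \<tau> x) \<in> ?W"
        using True by (intro transvection_group_gen) (simp add: Q_add Q)
      show "transvection (x + \<tau> x) (\<tau> x) = x"
        using True by (simp add: transvection_def B_add_left ac_simps)
      show "transvection (x + \<tau> x) f = f" if "\<tau> f = f" for f
        using Bf[OF that] by (intro transvection_fix) (simp add: B_add_left)
    qed
  next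
    case False
    then have xx: "B x (\<tau> x) = 0" by simp
    define F where "F = {f. B a f = 0 \<and> \<tau> f = f}"
    have F: "additive_subgroup F"
      unfolding additive_subgroup_def F_def using add add[of 0 0] by (auto simp: B_add_right)
    have tt: "\<tau> f = \<tau> x \<Longrightarrow> f = x" for f
    proof -
      assume "\<tau> f = \<tau> x"
      then have "\<tau> (f + x) = 0" using add by simp
      then have "B (f + x) y = 0" for y using B[of "f + x" y] by simp
      then show "f = x" using nondegenerate add_eq_0_iff_eq by blast
    qed
    \<comment> \<open>Equal values on \<open>x\<close> and \<open>\<tau> x\<close> amount to
      orthogonality to \<open>x + \<tau> x\<close>. If this sum is not yet in \<open>F\<close>, it
      is adjoined before separating \<open>x\<close>.\<close>
    obtain z1 where z1: "\<And>f. f \<in> F \<Longrightarrow> B z1 f = 0" "B z1 x = 1" "B z1 (\<tau> x) = 1"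
    proof (cases "x + \<tau> x \<in> F")
      case True
      have "x \<notin> F" using x by (simp add: F_def)
      then obtain z where z: "\<And>f. f \<in> F \<Longrightarrow> B z f = 0" "B z x = 1"
        using exists_separating[OF F] by blast
      moreover have "B z (\<tau> x) = 1" using z(1)[OF True] z(2) by (cases "B z (\<tau> x)") (simp_all add: B_add_right)
      ultimately show ?thesis using that by blast
    next
      case False
      let ?F = "F \<union> (+) (x + \<tau> x) ` F"
      have "x \<notin> ?F"
      proof
        assume "x \<in> ?F"
        then consider "x \<in> F" | f where "f \<in> F" "x = x + \<tau> x + f" by blast
        then show False
        proof cases
          case 1
          then show False using x by (simp add: F_def)
        next
          case 2
          then have "\<tau> x + f = 0" by (simp add: add.assoc)
          then have "\<tau> x = f" using add_eq_0_iff_eq by blast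
          moreover have "\<tau> f = f" using 2 by (simp add: F_def)
          ultimately have "f = x" using tt by simp
          then show False using 2(1) x by (simp add: F_def)
        qed
      qed
      then obtain z where z: "\<And>f. f \<in> ?F \<Longrightarrow> B z f = 0" "B z x = 1"
        using exists_separating[OF additive_subgroup_adjoin[OF F]] by blast
      have "x + \<tau> x + 0 \<in> ?F" using F unfolding additive_subgroup_def by blast
      then have "B z (x + \<tau> x) = 0" using z(1) by force
      then have "B z (\<tau> x) = 1" using z(2) by (cases "B z (\<tau> x)") (simp_all add: B_add_right)
      then show ?thesis using that[of z] z by blast
    qed
    \<comment> \<open>An intermediate stop between \<open>\<tau> x\<close> and \<open>x\<close>: it
      pairs with \<open>F\<close> as both of them do and is nonorthogonal to both. Hence
      transvections in \<open>z + \<tau> x\<close> and \<open>x + z\<close>, up to adding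
      \<open>a\<close>, lead from \<open>\<tau> x\<close> over \<open>z\<close> to \<open>x\<close>
      and fix \<open>F\<close>.\<close>
    define z where "z = x + z1"
    have z: "B z f = B x f" if "f \<in> F" for f using z1(1)[OF that] by (simp add: z_def B_add_left)
    have zx: "B z x = 1" "B z (\<tau> x) = 1" using z1 xx by (simp_all add: z_def B_add_left)
    have aF: "a \<in> F" using a by (simp add: F_def)
    have az: "B a z = 0" using z[OF aF] x by (simp add: B_sym)
    define n where "n y = (if Q y = 1 then y else y + a)" for y
    have nW: "transvection (n y) \<in> ?W" if "B a y = 0" for y
      using that a by (intro transvection_group_gen) (simp add: n_def Q_add B_sym)
    have nB: "B (n y) f = B y f" if "B a f = 0" for y f
      using that by (simp add: n_def B_add_left)
    let ?w = "transvection (n (x + z)) \<circ> transvection (n (z + \<tau> x))"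
    have w_W: "?w \<in> ?W" using az x ax' by (intro transvection_group_comp nW) (simp_all add: B_add_right)
    have "transvection (n (z + \<tau> x)) (\<tau> x) \<in> {z, z + a}"
      using zx ax' nB[OF ax', of "z + \<tau> x"]
      by (auto simp: transvection_def B_add_left) (auto simp: n_def ac_simps)
    moreover have "transvection (n (x + z)) z \<in> {x, x + a}"
      "transvection (n (x + z)) (z + a) \<in> {x, x + a}"
      using zx az nB[OF az, of "x + z"] nB[of a "x + z"] x a
      by (auto simp: transvection_def form_simps B_sym) (auto simp: n_def ac_simps)
    ultimately have "?w (\<tau> x) \<in> {x, x + a}" by auto
    \<comment> \<open>The remaining ambiguity is settled by \<open>Q\<close>, since
      \<open>Q (x + a) = Q x + 1\<close>.\<close>
    moreover have "Q (?w (\<tau> x)) = Q x"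
      using transvection_group_Q[OF w_W] Q by simp
    ultimately have "?w (\<tau> x) = x" using a x by (auto simp: Q_add B_sym)
    moreover have "?w f = f" if "B a f = 0" "\<tau> f = f" for f
    proof -
      have "f \<in> F" using that by (simp add: F_def)
      then have "B (n (x + z)) f = 0" "B (n (z + \<tau> x)) f = 0"
        using nB[OF that(1)] z Bf[OF that(2)] by (simp_all add: B_add_left)
      then show ?thesis by (simp add: transvection_fix)
    qed
    ultimately show ?thesis using that[OF w_W] by blast
  qed
qed

text \<open>For \<open>b\<close> with \<open>B a b = 1\<close>, the displacement
  \<open>b + \<tau> b\<close> is orthogonal to everything orthogonal to \<open>a\<close>, hence is 0
  or \<open>a\<close>. It determines \<open>\<tau>\<close>, because \<open>b\<close> together with
  the hyperplane spans the space.\<close>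

lemma fixes_hyperplane_cases:
  assumes add: "\<And>u v. \<tau> (u + v) = \<tau> u + \<tau> v" and Q: "\<And>v. Q (\<tau> v) = Q v"
    and a: "Q a = 1" and fixes_perp: "\<And>x. B a x = 0 \<Longrightarrow> \<tau> x = x"
  shows "\<tau> \<in> {id, transvection a}"
proof -
  have B: "B (\<tau> u) (\<tau> v) = B u v" for u v using isometry_B add Q by blast
  have "a \<noteq> 0" using a by auto
  then obtain b where b: "B a b = 1" using exists_B_eq_1 by blast
  define c where "c = b + \<tau> b"
  have perp: "B c f = 0" if "B a f = 0" for f
    using B[of b f] fixes_perp[OF that] by (simp add: c_def B_add_left)
  have split: "B a (v + b) = 0" if "B a v = 1" for v using that b by (simp add: B_add_right)
  have Bc: "B c v = B a v * B c b" for v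
  proof (cases "B a v = 0")
    case True
    then show ?thesis using perp by simp
  next
    case False
    then have "B c v + B c b = 0" using perp[OF split] by (simp add: B_add_right)
    then show ?thesis using False by (cases "B c v"; cases "B c b") simp_all
  qed
  have w: "b + \<tau> b \<in> {0, a}"
  proof (cases "B c b = 0")
    case True
    then have "B c v = 0" for v using Bc[of v] by simp
    then have "c = 0" by (rule nondegenerate)
    then show ?thesis by (simp add: c_def)
  next
    case False
    then have "B (c + a) v = 0" for v using Bc[of v] by (simp add: B_add_left)
    then have "c + a = 0" by (rule nondegenerate)
    then show ?thesis using add_eq_0_iff_eq[of c a] by (simp add: c_def)
  qed
  have \<tau>v: "\<tau> v = (if B a v = 0 then v else v + (b + \<tau> b))" for v
  proof (cases "B a v = 0")
    case True
    then show ?thesis using fixes_perp by simp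
  next
    case False
    then have "\<tau> (v + b) = v + b" using fixes_perp split[of v] by simp
    then have "\<tau> v + \<tau> b + \<tau> b = v + b + \<tau> b" using add by simp
    then show ?thesis using False by (simp add: add.assoc)
  qed
  from w consider "b + \<tau> b = 0" | "b + \<tau> b = a" by blast
  then show ?thesis
  proof cases
    case 1
    then have "\<tau> = id" using \<tau>v by (auto simp: fun_eq_iff)
    then show ?thesis by simp
  next
    case 2
    then have "\<tau> = transvection a" using \<tau>v by (auto simp: fun_eq_iff transvection_def)
    then show ?thesis by simp
  qed
qed

text \<open>Among the \<open>w\<close> with \<open>w (\<sigma> a) = a\<close>, one is chosen for
  which \<open>w \<circ> \<sigma>\<close> fixes the most vectors orthogonal to \<open>a\<close>;
  \<open>enlarge_fixed_space\<close> shows that it fixes all of them. The transitivity assumption is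
  a genuine restriction: in the orthogonal sum of two anisotropic planes the transvections preserve
  each plane, whereas an isometry can exchange them.\<close>

lemma orthogonal_generated_by_transvections:
  assumes add: "\<And>u v. \<sigma> (u + v) = \<sigma> u + \<sigma> v" and Q: "\<And>v. Q (\<sigma> v) = Q v"
    and a: "Q a = 1"
    and trans: "\<And>x y. Q x = 1 \<Longrightarrow> Q y = 1 \<Longrightarrow> \<exists>w\<in>transvection_group {v. Q v = 1}. w x = y"
  shows "\<sigma> \<in> transvection_group {v. Q v = 1}"
proof -
  let ?W = "transvection_group {v. Q v = 1}"
  let ?P = "\<lambda>w. w \<in> ?W \<and> w (\<sigma> a) = a"
  let ?F = "\<lambda>w. {f. B a f = 0 \<and> w (\<sigma> f) = f}"
  obtain w0 where w0: "?P w0" using trans[of "\<sigma> a" a] a Q by auto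
  have "\<exists>w. ?P w \<and> (\<forall>w'. ?P w' \<longrightarrow> card (?F w') \<le> card (?F w))"
    using w0 by (rule ex_greatest_card[where P = ?P])
  then obtain w where w: "w \<in> ?W" "w (\<sigma> a) = a"
    and max: "\<And>w'. w' \<in> ?W \<Longrightarrow> w' (\<sigma> a) = a \<Longrightarrow> card (?F w') \<le> card (?F w)" by blast
  let ?\<tau> = "w \<circ> \<sigma>"
  have \<tau>: "?\<tau> (u + v) = ?\<tau> u + ?\<tau> v" "Q (?\<tau> v) = Q v" for u v
    using add Q transvection_group_add[OF w(1)] transvection_group_Q[OF w(1)] by auto
  have \<tau>a: "?\<tau> a = a" using w(2) by simp
  have "?\<tau> x = x" if x: "B a x = 0" for x
  proof (rule ccontr)
    assume "?\<tau> x \<noteq> x"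
    then obtain u where u: "u \<in> ?W" "u (?\<tau> x) = x"
      "\<And>f. B a f = 0 \<Longrightarrow> ?\<tau> f = f \<Longrightarrow> u f = f"
      using enlarge_fixed_space[OF \<tau> a \<tau>a x \<open>?\<tau> x \<noteq> x\<close>] by blast
    have "?F w \<subset> ?F (u \<circ> w)"
    proof
      show "?F w \<subseteq> ?F (u \<circ> w)" using u(3) by auto
      show "?F w \<noteq> ?F (u \<circ> w)" using u(2) x \<open>?\<tau> x \<noteq> x\<close> by auto
    qed
    then have "card (?F w) < card (?F (u \<circ> w))" by (intro psubset_card_mono) simp_all
    moreover have "u a = a" using u(3)[of a] w(2) by simp
    ultimately show False
      using max[OF transvection_group_comp[OF u(1) w(1)]] w(2) by simp
  qed
  then have "?\<tau> \<in> {id, transvection a}"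
    using fixes_hyperplane_cases[OF \<tau> a] by blast
  then have "?\<tau> \<in> ?W"
    using a transvection_group.id transvection_group_gen by auto
  moreover obtain v where v: "v \<in> ?W" "v \<circ> w = id" using transvection_group_inverse[OF w(1)] by blast
  then have "\<sigma> = v \<circ> ?\<tau>" by (simp flip: comp_assoc)
  ultimately show ?thesis using transvection_group_comp v(1) by metis
qed

subsection \<open>Anisotropic planes and values on cosets\<close>

lemma card_le_double_kernel:
  assumes "additive_subgroup G"
  shows "card G \<le> 2 * card {x \<in> G. B p x = 0}"
proof (cases "\<exists>z\<in>G. B p z = 1")
  case True
  then obtain z where z: "z \<in> G" "B p z = 1" by blast
  have "(+) z ` {x \<in> G. B p x = 1} \<subseteq> {x \<in> G. B p x = 0}"
    using assms z by (auto simp: additive_subgroup_def B_add_right)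
  then have "card {x \<in> G. B p x = 1} \<le> card {x \<in> G. B p x = 0}"
    using card_mono[OF finite_subset_space] by (metis (no_types, lifting) card_image inj_on_add)
  moreover have "G = {x \<in> G. B p x = 0} \<union> {x \<in> G. B p x = 1}" by auto
  then have "card G \<le> card {x \<in> G. B p x = 0} + card {x \<in> G. B p x = 1}"
    by (metis (no_types, lifting) card_Un_le)
  ultimately show ?thesis by linarith
next
  case False
  then have "{x \<in> G. B p x = 0} = G" by auto
  then show ?thesis by simp
qed

definition nondegenerate_on :: "'v set \<Rightarrow> bool"
  where "nondegenerate_on U \<longleftrightarrow> (\<forall>u\<in>U. (\<forall>v\<in>U. B v u = 0) \<longrightarrow> u = 0)"

text \<open>A totally isotropic subspace of a nondegenerate space of order 64 has order at most 8, so the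
  kernel of two functionals contains a hyperbolic pair \<open>x, y\<close>. On each coset of
  \<open>\<langle>x, y\<rangle>\<close> the values of \<open>Q\<close> sum to \<open>B x y = 1\<close>, and one of these cosets avoids
  \<open>e1\<close> and \<open>e2\<close>.\<close>

lemma exists_root_in_coset:
  assumes U: "additive_subgroup U" "card U = 64" "nondegenerate_on U"
  obtains u where "u \<in> U" "B p u = 0" "B q u = 0" "Q (r + u) = 1" "u \<noteq> e1" "u \<noteq> e2"
proof -
  define K where "K = {u \<in> {u \<in> U. B p u = 0}. B q u = 0}"
  have K1: "additive_subgroup {u \<in> U. B p u = 0}"
    using U(1) by (simp add: additive_subgroup_def B_add_right)
  then have K: "additive_subgroup K"
    by (simp add: K_def additive_subgroup_def B_add_right)
  have "16 \<le> card K"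
    using card_le_double_kernel[OF U(1), of p] card_le_double_kernel[OF K1, of q] U(2)
    by (simp add: K_def)
  have KU: "K \<subseteq> U" by (auto simp: K_def)
  have "\<exists>x\<in>K. \<exists>y\<in>K. B x y = 1"
  proof (rule ccontr)
    assume "\<not> ?thesis"
    then have "K \<subseteq> {u \<in> U. \<forall>k\<in>K. B u k = 0}" using KU by auto
    then have "card K \<le> card {u \<in> U. \<forall>k\<in>K. B u k = 0}" by (intro card_mono) simp_all
    then have "card K * card K \<le> card K * card {u \<in> U. \<forall>k\<in>K. B u k = 0}" by simp
    also have "\<dots> = card U"
      using U(3) KU by (intro card_perp[OF U(1) K]) (auto simp: nondegenerate_on_def)
    finally have "card K * card K \<le> card U" .
    moreover have "16 * 16 \<le> card K * card K" using \<open>16 \<le> card K\<close> by (intro mult_le_mono)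
    ultimately show False using U(2) by linarith
  qed
  then obtain x y where xy: "x \<in> K" "y \<in> K" "B x y = 1" by blast
  define L where "L = {0, x, y, x + y}"
  have "card L \<le> 4" unfolding L_def by (intro order.trans[OF card_insert_le_m1]) auto
  have "card ((+) e1 ` L \<union> (+) e2 ` L) \<le> card ((+) e1 ` L) + card ((+) e2 ` L)"
    by (rule card_Un_le)
  also have "\<dots> \<le> card L + card L" by (intro add_mono card_image_le) simp_all
  finally have "card ((+) e1 ` L \<union> (+) e2 ` L) < card K"
    using \<open>card L \<le> 4\<close> \<open>16 \<le> card K\<close> by linarith
  then have "\<not> K \<subseteq> (+) e1 ` L \<union> (+) e2 ` L"
    by (meson card_mono finite_subset_space linorder_not_le)
  then obtain u where u: "u \<in> K" "u \<notin> (+) e1 ` L" "u \<notin> (+) e2 ` L" by blast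
  have "Q (r + u) + Q (r + (u + x)) + Q (r + (u + y)) + Q (r + (u + (x + y))) = 1"
    using xy(3) by (simp add: form_simps ac_simps)
  then have "\<exists>l\<in>L. Q (r + (u + l)) = 1"
    unfolding L_def by (cases "Q (r + u)"; cases "Q (r + (u + x))"; cases "Q (r + (u + y))") auto
  then obtain l where l: "l \<in> L" "Q (r + (u + l)) = 1" by blast
  have "l \<in> K" using l(1) xy K by (auto simp: L_def additive_subgroup_def)
  then have "u + l \<in> K" using u(1) K by (simp add: additive_subgroup_def)
  moreover have "u + l \<noteq> e" if "u \<notin> (+) e ` L" for e
  proof
    assume "u + l = e"
    then have "u = e + l" by (auto simp: add.assoc)
    then show False using that l(1) by blast
  qed
  ultimately show ?thesis using that[of "u + l"] l(2) u(2,3) by (auto simp: K_def)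
qed

text \<open>The reduction modulo 2 of a root system of type A_2: its three nonzero vectors are the
  three pairs of opposite roots.\<close>

definition anisotropic_plane :: "'v set \<Rightarrow> bool"
  where "anisotropic_plane P \<longleftrightarrow>
    additive_subgroup P \<and> card P = 4 \<and> (\<forall>x\<in>P. x \<noteq> 0 \<longrightarrow> Q x = 1)"

lemma anisotropic_planeI:
  assumes "Q x = 1" "Q y = 1" "B x y = 1"
  shows "anisotropic_plane {0, x, y, x + y}"
proof -
  have "x \<noteq> 0" "y \<noteq> 0" "x \<noteq> y" using assms by auto
  then have "card {0, x, y, x + y} = 4"
    by (auto simp: card_insert_if add_eq_0_iff_eq)
  moreover have "additive_subgroup {0, x, y, x + y}"
    by (auto simp: additive_subgroup_def ac_simps)
  ultimately show ?thesis using assms by (auto simp: anisotropic_plane_def Q_add)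
qed

lemma anisotropic_plane_B:
  assumes "anisotropic_plane P" "x \<in> P" "y \<in> P" "x \<noteq> 0" "y \<noteq> 0" "x \<noteq> y"
  shows "B x y = 1"
proof -
  have "x + y \<in> P" "x + y \<noteq> 0"
    using assms by (auto simp: anisotropic_plane_def additive_subgroup_def add_eq_0_iff_eq)
  then show ?thesis using assms Q_add[of x y] by (simp add: anisotropic_plane_def)
qed

lemma anisotropic_plane_nondegenerate:
  assumes "anisotropic_plane P" "x \<in> P" "\<And>y. y \<in> P \<Longrightarrow> B y x = 0"
  shows "x = 0"
proof (rule ccontr)
  assume "x \<noteq> 0"
  have "card {0, x} < card P" using assms(1) by (simp add: anisotropic_plane_def card_insert_if)
  then have "\<not> P \<subseteq> {0, x}" by (meson card_mono finite_subset_space linorder_not_le)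
  then obtain y where "y \<in> P" "y \<noteq> 0" "y \<noteq> x" by blast
  then show False using anisotropic_plane_B[OF assms(1) _ assms(2), of y] assms(3) \<open>x \<noteq> 0\<close> by force
qed

end

section \<open>Root systems\<close>

text \<open>The last axiom is connectedness of the nonorthogonality graph on \<open>D\<close>, put
  as an induction principle. Simple roots do not appear, so the results depend on the set
  \<open>D\<close> only.\<close>

locale root_system = quadratic_space +
  fixes D
  assumes root_Q: "x \<in> D \<Longrightarrow> Q x = 1"
    and root_add: "x \<in> D \<Longrightarrow> y \<in> D \<Longrightarrow> B x y = 1 \<Longrightarrow> x + y \<in> D"
    and roots_span: "additive_subgroup M \<Longrightarrow> D \<subseteq> M \<Longrightarrow> M = UNIV"
    and roots_connected: "X \<subseteq> D \<Longrightarrow> X \<noteq> {} \<Longrightarrow>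
      (\<And>x y. x \<in> X \<Longrightarrow> y \<in> D \<Longrightarrow> B x y = 1 \<Longrightarrow> y \<in> X) \<Longrightarrow> X = D"
begin

text \<open>The root \<open>x + y\<close> of \<open>P\<close> is nonorthogonal to
  \<open>x + w\<close>, because \<open>w\<close> contributes nothing; adding it trades
  \<open>x\<close> for \<open>y\<close>.\<close>

lemma root_exchange:
  assumes P: "anisotropic_plane P" "P - {0} \<subseteq> D" and w: "\<And>x. x \<in> P \<Longrightarrow> B x w = 0"
    and x: "x \<in> P" "x \<noteq> 0" "x + w \<in> D" and y: "y \<in> P" "y \<noteq> 0"
  shows "y + w \<in> D"
proof (cases "x = y")
  case False
  have "x + y \<in> P" "x + y \<noteq> 0"
    using P(1) x y False by (auto simp: anisotropic_plane_def additive_subgroup_def add_eq_0_iff_eq)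
  then have "x + y \<in> D" using P(2) by blast
  moreover have "B (x + y) (x + w) = 1"
    using anisotropic_plane_B[OF P(1) x(1) y(1) x(2) y(2) False] w[OF x(1)] w[OF y(1)]
    by (simp add: form_simps B_sym)
  ultimately have "(x + y) + (x + w) \<in> D" using root_add x(3) by blast
  then show ?thesis by (simp add: ac_simps)
qed (use x in simp)

text \<open>On the orthogonal sum of the planes, \<open>Q\<close> is the parity of the number of
  nonzero components. The nonsingular vectors are thus the 9 with one nonzero component and the 27
  with three; the latter arise from \<open>x0 + y0 + z0\<close> by exchanging one component at a
  time.\<close>

lemma three_planes:
  assumes P1: "anisotropic_plane P1" "P1 - {0} \<subseteq> D"
    and P2: "anisotropic_plane P2" "P2 - {0} \<subseteq> D"
    and P3: "anisotropic_plane P3" "P3 - {0} \<subseteq> D"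
    and o12: "\<And>x y. x \<in> P1 \<Longrightarrow> y \<in> P2 \<Longrightarrow> B x y = 0"
    and o13: "\<And>x y. x \<in> P1 \<Longrightarrow> y \<in> P3 \<Longrightarrow> B x y = 0"
    and o23: "\<And>x y. x \<in> P2 \<Longrightarrow> y \<in> P3 \<Longrightarrow> B x y = 0"
    and t: "x0 \<in> P1 - {0}" "y0 \<in> P2 - {0}" "z0 \<in> P3 - {0}" "x0 + y0 + z0 \<in> D"
  obtains U where "additive_subgroup U" "card U = 64" "nondegenerate_on U" "x0 \<in> U"
    "\<And>u. u \<in> U \<Longrightarrow> Q u = 1 \<Longrightarrow> u \<in> D"
proof -
  define U where "U = (\<lambda>(x, y, z). x + y + z) ` (P1 \<times> P2 \<times> P3)"
  have sub: "0 \<in> P1" "0 \<in> P2" "0 \<in> P3"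
    "\<And>x y. x \<in> P1 \<Longrightarrow> y \<in> P1 \<Longrightarrow> x + y \<in> P1"
    "\<And>x y. x \<in> P2 \<Longrightarrow> y \<in> P2 \<Longrightarrow> x + y \<in> P2"
    "\<And>x y. x \<in> P3 \<Longrightarrow> y \<in> P3 \<Longrightarrow> x + y \<in> P3"
    using P1 P2 P3 by (auto simp: anisotropic_plane_def additive_subgroup_def)
  have UI: "x + y + z \<in> U" if "x \<in> P1" "y \<in> P2" "z \<in> P3" for x y z
    using that by (force simp: U_def)
  have P_sub: "P1 \<subseteq> U" "P2 \<subseteq> U" "P3 \<subseteq> U"
    using UI[OF _ sub(2,3)] UI[OF sub(1) _ sub(3)] UI[OF sub(1,2)] by auto
  \<comment> \<open>This gives both the uniqueness of the decomposition, hence the order 64, and the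
    nondegeneracy of \<open>U\<close>.\<close>
  have triv: "x = 0 \<and> y = 0 \<and> z = 0"
    if m: "x \<in> P1" "y \<in> P2" "z \<in> P3" and 0: "\<And>v. v \<in> U \<Longrightarrow> B v (x + y + z) = 0" for x y z
  proof (intro conjI)
    show "x = 0"
      using anisotropic_plane_nondegenerate[OF P1(1) m(1)] 0 P_sub(1) o12 o13 m
      by (force simp: B_add_right)
    show "y = 0"
      using anisotropic_plane_nondegenerate[OF P2(1) m(2)] 0 P_sub(2) o12 o23 m
      by (force simp: B_add_right B_sym[of _ x])
    show "z = 0"
      using anisotropic_plane_nondegenerate[OF P3(1) m(3)] 0 P_sub(3) o13 o23 m
      by (force simp: B_add_right B_sym[of _ x] B_sym[of _ y])
  qed
  show ?thesis
  proof (rule that[of U])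
    show "additive_subgroup U"
      unfolding additive_subgroup_def
    proof (intro conjI ballI)
      show "0 \<in> U" using UI[OF sub(1-3)] by simp
      fix u v assume "u \<in> U" "v \<in> U"
      then obtain x y z x' y' z' where "u = x + y + z" "v = x' + y' + z'"
        "x \<in> P1" "y \<in> P2" "z \<in> P3" "x' \<in> P1" "y' \<in> P2" "z' \<in> P3"
        by (auto simp: U_def)
      moreover from this have "u + v = (x + x') + (y + y') + (z + z')" by (simp add: ac_simps)
      ultimately show "u + v \<in> U" using UI sub by metis
    qed
    have "inj_on (\<lambda>(x, y, z). x + y + z) (P1 \<times> P2 \<times> P3)"
    proof (rule inj_onI)
      fix p q
      assume pq: "p \<in> P1 \<times> P2 \<times> P3" "q \<in> P1 \<times> P2 \<times> P3"
        and e: "(case p of (x, y, z) \<Rightarrow> x + y + z) = (case q of (x, y, z) \<Rightarrow> x + y + z)"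
      obtain x y z x' y' z' where [simp]: "p = (x, y, z)" "q = (x', y', z')"
        by (cases p; cases q) auto
      have m: "x \<in> P1" "y \<in> P2" "z \<in> P3" "x' \<in> P1" "y' \<in> P2" "z' \<in> P3"
        and eq: "x + y + z = x' + y' + z'" using pq e by auto
      have "(x + x') + (y + y') + (z + z') = (x + y + z) + (x' + y' + z')" by (simp only: ac_simps)
      then have "(x + x') + (y + y') + (z + z') = 0" using eq by simp
      then have "x + x' = 0 \<and> y + y' = 0 \<and> z + z' = 0"
        using triv[of "x + x'" "y + y'" "z + z'"] m sub by simp
      then show "p = q" by (simp add: add_eq_0_iff_eq)
    qed
    then have "card U = card (P1 \<times> P2 \<times> P3)" unfolding U_def by (rule card_image)
    also have "\<dots> = 64" using P1 P2 P3 by (simp add: anisotropic_plane_def card_cartesian_product)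
    finally show "card U = 64" .
    show "nondegenerate_on U"
      unfolding nondegenerate_on_def
    proof (intro ballI impI)
      fix u assume "u \<in> U" and 0: "\<forall>v\<in>U. B v u = 0"
      then obtain x y z where "u = x + y + z" "x \<in> P1" "y \<in> P2" "z \<in> P3"
        by (auto simp: U_def)
      then show "u = 0" using triv[of x y z] 0 by simp
    qed
    show "x0 \<in> U" using t(1) P_sub by blast
    fix u assume "u \<in> U" and u: "Q u = 1"
    then obtain x y z where m: "u = x + y + z" "x \<in> P1" "y \<in> P2" "z \<in> P3"
      by (auto simp: U_def)
    have q: "v \<in> P1 \<union> P2 \<union> P3 \<Longrightarrow> Q v = (if v = 0 then 0 else 1)" for v
      using P1(1) P2(1) P3(1) by (auto simp: anisotropic_plane_def)
    have "Q u = Q x + Q y + Q z" using m o12 o13 o23 by (simp add: form_simps)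
    then consider "x \<noteq> 0" "y = 0" "z = 0" | "x = 0" "y \<noteq> 0" "z = 0" | "x = 0" "y = 0" "z \<noteq> 0"
      | "x \<noteq> 0" "y \<noteq> 0" "z \<noteq> 0"
      using u m q[of x] q[of y] q[of z] by (auto split: if_splits)
    then show "u \<in> D"
    proof cases
      case 4
      have "x + (y0 + z0) \<in> D"
        using root_exchange[OF P1, of "y0 + z0" x0 x] 4 m t o12 o13 by (simp add: B_add_right add.assoc)
      then have "y0 + (x + z0) \<in> D" by (simp add: ac_simps)
      then have "y + (x + z0) \<in> D"
        using root_exchange[OF P2, of "x + z0" y0 y] 4 m t o12 o23 by (simp add: B_add_right B_sym[of _ x])
      then have "z0 + (x + y) \<in> D" by (simp add: ac_simps)
      then have "z + (x + y) \<in> D"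
        using root_exchange[OF P3, of "x + y" z0 z] 4 m t o13 o23
        by (simp add: B_add_right B_sym[of _ x] B_sym[of _ y])
      then show ?thesis using m(1) by (simp add: ac_simps)
    qed (use m P1 P2 P3 in auto)
  qed
qed

subsection \<open>Growth from an \<open>E\<^sub>6\<close> configuration\<close>

text \<open>The last premise exempts the radical of \<open>M\<close>, whose vectors cannot be
  produced by adding nonorthogonal elements of \<open>M\<close>.\<close>

definition saturated :: "'a set \<Rightarrow> bool"
  where "saturated M \<longleftrightarrow>
    additive_subgroup M \<and> (\<forall>v\<in>M. Q v = 1 \<longrightarrow> (\<exists>m\<in>M. B m v = 1) \<longrightarrow> v \<in> D)"

text \<open>Two solutions would differ by an element of \<open>U\<close> orthogonal to all of
  \<open>U\<close>. The vector \<open>e\<close> is the one that \<open>exists_root_in_coset\<close>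
  is told to avoid.\<close>

lemma coset_meets_radical_once:
  assumes U: "additive_subgroup U" "nondegenerate_on U" "U \<subseteq> M"
  shows "\<exists>e. \<forall>u\<in>U. (\<forall>m\<in>M. B m (r + u) = 0) \<longrightarrow> u = e"
proof -
  have "u = e" if "u \<in> U" "e \<in> U" "\<forall>m\<in>M. B m (r + u) = 0" "\<forall>m\<in>M. B m (r + e) = 0" for u e
  proof -
    have "B m (u + e) = 0" if "m \<in> U" for m
    proof -
      have "B m ((r + u) + (r + e)) = 0" using that \<open>\<forall>m\<in>M. B m (r + u) = 0\<close>
        \<open>\<forall>m\<in>M. B m (r + e) = 0\<close> U(3) by (subst B_add_right) auto
      then show ?thesis by (simp add: ac_simps)
    qed
    then have "u + e = 0"
      using U(1,2) that(1,2) by (auto simp: nondegenerate_on_def additive_subgroup_def)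
    then show "u = e" by (simp add: add_eq_0_iff_eq)
  qed
  then show ?thesis by metis
qed

text \<open>For a suitable root \<open>r\<close> in \<open>M\<close>, the vector \<open>d + v = (d + r) + (v + r)\<close> is a sum of two
  nonorthogonal roots.\<close>

lemma root_translate:
  assumes U: "additive_subgroup U" "card U = 64" "nondegenerate_on U" "U \<subseteq> M"
    and M: "saturated M" and d: "d \<in> D" "m \<in> M" "B d m = 1"
    and v: "v \<in> M" "Q v = B d v"
    and rad: "(\<forall>m\<in>M. B m v = 0) \<Longrightarrow> Q v = 0"
    and nonrad: "\<And>n. n \<in> M \<Longrightarrow> B n v = 1 \<Longrightarrow> \<exists>s\<in>M. B d s \<noteq> B v s"
  shows "d + v \<in> D"
proof -
  have add: "\<And>x y. x \<in> M \<Longrightarrow> y \<in> M \<Longrightarrow> x + y \<in> M"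
    using M by (simp add: saturated_def additive_subgroup_def)
  \<comment> \<open>Once \<open>Q r = 1\<close>, these values yield \<open>Q (v + r) = 1\<close> and
    \<open>B (d + r) (v + r) = 1\<close>. They can be prescribed because \<open>B d\<close> and
    \<open>B v\<close> are linearly independent on \<open>M\<close>, unless \<open>v\<close> is
    radical, where \<open>Q v = 0\<close> and \<open>m\<close> itself works.\<close>
  have "\<exists>r\<in>M. B d r = 1 \<and> B v r = Q v"
  proof (cases "\<forall>m\<in>M. B m v = 0")
    case True
    then show ?thesis using rad d(2,3) by (metis B_sym)
  next
    case False
    then obtain n where n: "n \<in> M" "B n v = 1" by auto
    then obtain s where s: "s \<in> M" "B d s \<noteq> B v s"
      using M d nonrad[of n] by auto
    have mn: "m + n \<in> M" "m + s \<in> M" using add d n s by auto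
    show ?thesis
    proof (cases "B v m = Q v")
      case True
      then show ?thesis using d by blast
    next
      case vm: False
      show ?thesis
      proof (cases "Q v = 1")
        case True
        then have "B v m = 0" using vm by simp
        then show ?thesis
        proof (cases "B d n = 1")
          case True
          then show ?thesis using n \<open>Q v = 1\<close> B_sym by metis
        next
          case False
          then show ?thesis using n d \<open>Q v = 1\<close> \<open>B v m = 0\<close> mn(1)
            by (intro bexI[of _ "m + n"]) (simp_all add: B_add_right B_sym[of v n])
        qed
      next
        case False
        then have 0: "Q v = 0" "B v m = 1" using vm by auto
        show ?thesis
        proof (cases "B d s = 1")
          case True
          then show ?thesis using s 0 by (intro bexI[of _ s]) auto
        next
          case False
          then show ?thesis using s 0 d mn(2) by (intro bexI[of _ "m + s"]) (simp_all add: B_add_right)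
        qed
      qed
    qed
  qed
  then obtain r0 where r0: "r0 \<in> M" "B d r0 = 1" "B v r0 = Q v" by blast
  \<comment> \<open>It remains to correct \<open>Q r0\<close> by a translation inside
    \<open>U\<close> that respects both functionals. The translations by \<open>e1\<close> and
    \<open>e2\<close> are the only ones that could put \<open>r\<close> or \<open>v + r\<close> into
    the radical.\<close>
  obtain e1 e2 where e1: "\<forall>u\<in>U. (\<forall>m\<in>M. B m (r0 + u) = 0) \<longrightarrow> u = e1"
    and e2: "\<forall>u\<in>U. (\<forall>m\<in>M. B m (v + r0 + u) = 0) \<longrightarrow> u = e2"
    using coset_meets_radical_once[OF U(1,3,4)] by metis
  obtain u where u: "u \<in> U" "B d u = 0" "B v u = 0" "Q (r0 + u) = 1" "u \<noteq> e1" "u \<noteq> e2"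
    using exists_root_in_coset[OF U(1-3)] by blast
  define r where "r = r0 + u"
  have r: "r \<in> M" "Q r = 1" "B d r = 1" "B v r = Q v"
    using r0 u U(4) add by (auto simp: r_def B_add_right)
  have "\<exists>m\<in>M. B m r = 1" "\<exists>m\<in>M. B m (v + r) = 1"
    using e1 e2 u by (auto simp: r_def add.assoc)
  moreover have "Q (v + r) = 1" using r Q_add[of v r] by (cases "Q v") simp_all
  ultimately have "r \<in> D" "v + r \<in> D"
    using M r v add by (auto simp: saturated_def)
  then have "d + r \<in> D" using root_add d(1) r(3) by blast
  moreover have "B (d + r) (v + r) = 1"
    using r v by (simp add: form_simps B_sym[of r v] ac_simps)
  ultimately have "(d + r) + (v + r) \<in> D" using root_add \<open>v + r \<in> D\<close> by blast
  then show ?thesis by (simp add: ac_simps)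
qed

lemma saturated_adjoin:
  assumes U: "additive_subgroup U" "card U = 64" "nondegenerate_on U" "U \<subseteq> M"
    and M: "saturated M" and d: "d \<in> D" "m \<in> M" "B d m = 1"
  shows "saturated (M \<union> (+) d ` M)"
proof -
  let ?M = "M \<union> (+) d ` M"
  have sub: "additive_subgroup M" using M by (simp add: saturated_def)
  then have M0: "0 \<in> M" and add: "\<And>x y. x \<in> M \<Longrightarrow> y \<in> M \<Longrightarrow> x + y \<in> M"
    by (simp_all add: additive_subgroup_def)
  have dM: "d \<in> ?M" using M0 by force
  have Qd: "Q d = 1" using root_Q d by simp
  have inrad: "d + v \<in> D" if v: "v \<in> M" "Q v = B d v" and 0: "\<forall>m\<in>M. B m v = 0" for v
  proof (cases "Q v = 0")
    case True
    then show ?thesis using root_translate[OF U M d v] 0 by force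
  next
    case False
    \<comment> \<open>A radical \<open>v\<close> with \<open>Q v = 1\<close> is not covered by
      \<open>root_translate\<close>. Writing \<open>d + v\<close> as
      \<open>(d + r) + (v + r)\<close> with a root \<open>r\<close> of \<open>M\<close> replaces it
      by \<open>v + r\<close>, where \<open>Q\<close> vanishes.\<close>
    obtain e1 where e1: "\<forall>u\<in>U. (\<forall>n\<in>M. B n (m + u) = 0) \<longrightarrow> u = e1"
      using coset_meets_radical_once[OF U(1,3,4)] by metis
    obtain u where u: "u \<in> U" "B d u = 0" "Q (m + u) = 1" "u \<noteq> e1"
      using exists_root_in_coset[OF U(1-3)] by blast
    define r where "r = m + u"
    have r: "r \<in> M" "Q r = 1" "B d r = 1" using d u U(4) add by (auto simp: r_def B_add_right)
    have nr: "\<exists>n\<in>M. B n r = 1" using e1 u by (auto simp: r_def)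
    then have "r \<in> D" using M r by (auto simp: saturated_def)
    then have drD: "d + r \<in> D" using root_add d r by blast
    have Bvr: "B r v = 0" using 0 r by blast
    have "(d + r) + (v + r) \<in> D"
    proof (rule root_translate[OF U M drD r(1)])
      show "B (d + r) r = 1" using r by (simp add: B_add_left)
      show "v + r \<in> M" using add v r by blast
      show "Q (v + r) = B (d + r) (v + r)"
        using False r v Bvr by (simp add: form_simps B_sym[of v r])
      show "Q (v + r) = 0" using False r Bvr by (simp add: form_simps B_sym[of v r])
      show "\<exists>s\<in>M. B (d + r) s \<noteq> B (v + r) s"
        using r v 0 d by (intro bexI[of _ m]) (auto simp: B_add_left B_sym[of v])
    qed
    then show ?thesis by (simp add: ac_simps)
  qed
  show ?thesis
    unfolding saturated_def
  proof (intro conjI ballI impI)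
    show "additive_subgroup ?M" using sub by (rule additive_subgroup_adjoin)
    fix w assume w: "w \<in> ?M" "Q w = 1" "\<exists>m\<in>?M. B m w = 1"
    show "w \<in> D"
    proof (cases "w \<in> M")
      case wM: True
      show ?thesis
      proof (cases "\<exists>m\<in>M. B m w = 1")
        case True
        then show ?thesis using M w wM by (auto simp: saturated_def)
      next
        case False
        then have 0: "\<forall>m\<in>M. B m w = 0" by auto
        then have "B d w = 1" using w(3) by (auto simp: B_add_left)
        then have "d + w \<in> D" using inrad[OF wM] 0 w by simp
        moreover have "B d (d + w) = 1" using \<open>B d w = 1\<close> by (simp add: B_add_right)
        ultimately have "d + (d + w) \<in> D" using root_add d(1) by blast
        then show ?thesis by simp
      qed
    next
      case False
      then obtain v where v: "v \<in> M" "w = d + v" using w(1) by blast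
      then have Qv: "Q v = B d v" using w(2) Qd by (cases "Q v"; cases "B d v") (simp_all add: Q_add)
      show ?thesis
      proof (cases "\<forall>m\<in>M. B m v = 0")
        case True
        then show ?thesis using inrad v Qv by simp
      next
        case False
        \<comment> \<open>Otherwise \<open>w = d + v\<close> would be orthogonal to \<open>M\<close>
          and to \<open>d\<close>, and so would lie in the radical of the enlarged space.\<close>
        have "\<exists>s\<in>M. B d s \<noteq> B v s"
        proof (rule ccontr)
          assume "\<not> ?thesis"
          then have eq: "\<And>s. s \<in> M \<Longrightarrow> B d s = B v s" by blast
          then have "B d v = 0" using v(1) by simp
          have Mw: "B x w = 0" if "x \<in> M" for x
            using eq[OF that] v(2) by (simp add: B_add_right B_sym[of x])
          have "B d w = 0" using \<open>B d v = 0\<close> v(2) by (simp add: B_add_right)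
          then have "B x w = 0" if "x \<in> ?M" for x
            using that Mw by (auto simp: B_add_left)
          then show False using w(3) by auto
        qed
        then show ?thesis using root_translate[OF U M d v(1) Qv] False v(2) by blast
      qed
    qed
  qed
qed

text \<open>A largest saturated \<open>M\<close> above \<open>U\<close> contains \<open>D\<close>:
  by connectedness, a root outside would be nonorthogonal to some root inside and could be adjoined.
  Then \<open>M\<close> is the whole space, whose radical is zero, and the exemption in
  \<open>saturated\<close> disappears.\<close>

lemma all_roots:
  assumes U: "additive_subgroup U" "card U = 64" "nondegenerate_on U"
    and UD: "\<And>u. u \<in> U \<Longrightarrow> Q u = 1 \<Longrightarrow> u \<in> D" and x0: "x0 \<in> U" "x0 \<in> D"
  shows "D = {v. Q v = 1}"
proof -
  have "saturated U" using U UD by (simp add: saturated_def)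
  then obtain M where M: "saturated M" "U \<subseteq> M"
    and max: "\<And>M'. saturated M' \<Longrightarrow> U \<subseteq> M' \<Longrightarrow> card M' \<le> card M"
    using ex_greatest_card[of "\<lambda>M. saturated M \<and> U \<subseteq> M" U "\<lambda>M. M"] by auto
  have "D \<subseteq> M"
  proof (rule ccontr)
    assume "\<not> D \<subseteq> M"
    then have "D \<inter> M \<noteq> D" by blast
    moreover have "D \<inter> M \<noteq> {}" using x0 M by blast
    ultimately obtain m d where md: "m \<in> D \<inter> M" "d \<in> D" "B m d = 1" "d \<notin> M"
      using roots_connected[of "D \<inter> M"] by blast
    have "saturated (M \<union> (+) d ` M)"
      using saturated_adjoin[OF U M(2,1), of d m] md by (simp add: B_sym)
    then have "card (M \<union> (+) d ` M) \<le> card M" using max M(2) by blast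
    moreover have "card (M \<union> (+) d ` M) = 2 * card M"
      using card_adjoin md(4) M(1) by (simp add: saturated_def)
    moreover have "card M > 0" using M(2) x0(1) by (auto simp: card_gt_0_iff)
    ultimately show False by linarith
  qed
  then have "M = UNIV" using roots_span M(1) by (simp add: saturated_def)
  have "v \<in> D" if "Q v = 1" for v
  proof -
    have "v \<noteq> 0" using that by auto
    then have "\<exists>m\<in>M. B m v = 1" using exists_B_eq_1 \<open>M = UNIV\<close> B_sym by (metis UNIV_I)
    then show ?thesis using M(1) that \<open>M = UNIV\<close> by (auto simp: saturated_def)
  qed
  then show ?thesis using root_Q by auto
qed

section \<open>Six clique elements and a root of type E_6\<close>

text \<open>Two of the three differences sum to the third, and \<open>Q\<close> is 1 on all three,
  so polarization leaves no other value.\<close>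

lemma triangle_B:
  assumes "p + q \<in> D" "p + r \<in> D" "q + r \<in> D"
  shows "B (p + q) (p + r) = 1"
proof -
  have "(p + q) + (p + r) = q + r" by (simp add: ac_simps)
  then have "Q ((p + q) + (p + r)) = Q (q + r)" by (rule arg_cong)
  then show ?thesis using Q_add[of "p + q" "p + r"] assms root_Q by simp
qed

lemma square_B:
  assumes "p + q \<in> D" "p + r \<in> D" "p + t \<in> D" "q + r \<in> D" "q + t \<in> D"
  shows "B (p + q) (r + t) = 0"
proof -
  have "r + t = (p + r) + (p + t)" by (simp add: ac_simps)
  then have "B (p + q) (r + t) = B (p + q) (p + r) + B (p + q) (p + t)"
    by (metis B_add_right)
  then show ?thesis using triangle_B[of p q r] triangle_B[of p q t] assms by simp
qed

text \<open>The chain \<open>a1 + a2\<close>, \<open>a2 + a3\<close>, \<open>a3 + b1\<close>,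
  \<open>b1 + b2\<close>, \<open>b2 + b3\<close> has type A_5, and \<open>d\<close> is joined to its
  middle root only: this is the E_6 diagram. The three planes come from the extended diagram, which
  contains three orthogonal copies of A_2.\<close>

lemma E6_all_roots:
  assumes P: "sorted_wrt (\<lambda>x y. x + y \<in> D) [a1, a2, a3, b1, b2, b3]"
    and d: "d \<in> D" "B d (a1 + a2) = 0" "B d (a2 + a3) = 0" "B d (b1 + b2) = 0" "B d (b2 + b3) = 0"
      "B d (a1 + b1) = 1"
  shows "D = {v. Q v = 1}"
proof -
  have sums: "a1 + a2 \<in> D" "a1 + a3 \<in> D" "a2 + a3 \<in> D" "b1 + b2 \<in> D" "b1 + b3 \<in> D" "b2 + b3 \<in> D"
    "a1 + b1 \<in> D" "a1 + b2 \<in> D" "a1 + b3 \<in> D" "a2 + b1 \<in> D" "a2 + b2 \<in> D" "a2 + b3 \<in> D"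
    "a3 + b1 \<in> D" "a3 + b2 \<in> D" "a3 + b3 \<in> D"
    using P by simp_all
  have sums': "a2 + a1 \<in> D" "a3 + a1 \<in> D" "a3 + a2 \<in> D" "b2 + b1 \<in> D" "b3 + b1 \<in> D" "b3 + b2 \<in> D" "b1 + a1 \<in> D"
    "b2 + a1 \<in> D" "b3 + a1 \<in> D" "b1 + a2 \<in> D" "b2 + a2 \<in> D" "b3 + a2 \<in> D" "b1 + a3 \<in> D" "b2 + a3 \<in> D" "b3 + a3 \<in> D"
    by (simp_all only: add.commute sums)
  \<comment> \<open>Modulo 2 this is the highest root of E_6: the odd coefficients in 1, 2, 3, 2, 1
    along the chain leave \<open>(a1 + a2) + (a3 + b1) + (b2 + b3)\<close>, and \<open>d\<close> has
    coefficient 2. With \<open>d\<close> it spans the third plane.\<close>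
  define s where "s = (a1 + b1) + (a2 + b2) + (a3 + b3)"
  have B0: "B (a1 + a2) (a3 + b1) = 0" "B (a1 + a2) (b2 + b3) = 0" "B (a2 + a3) (a1 + b1) = 0"
    "B (a2 + a3) (b2 + b3) = 0" "B (b1 + b2) (a1 + b3) = 0" "B (b1 + b2) (a2 + a3) = 0"
    "B (b2 + b3) (a1 + b1) = 0" "B (b2 + b3) (a2 + a3) = 0" "B (a1 + a2) (b1 + b2) = 0"
    "B (a2 + a3) (b1 + b2) = 0" "B (a1 + b1) (a2 + b2) = 0" "B (a1 + b1) (a3 + b3) = 0"
    "B (a2 + b2) (a3 + b3) = 0"
    by (rule square_B; rule sums sums')+
  have s_eq: "s = (a1 + a2) + (a3 + b1) + (b2 + b3)" "s = (a2 + a3) + (a1 + b1) + (b2 + b3)"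
    "s = (b1 + b2) + (a1 + b3) + (a2 + a3)"
    by (simp_all only: s_def ac_simps)
  have sperp: "B (a1 + a2) s = 0" "B (a2 + a3) s = 0" "B (b1 + b2) s = 0" "B (b2 + b3) s = 0"
    by (simp only: s_eq(1) B_add_right[of _ "_ + _ + _"] B_add_right[of "a1 + a2" "a1 + a2"] B0 B_self add_0_left,
        simp only: s_eq(2) B_add_right[of "a2 + a3" "_ + _ + _"] B_add_right[of "a2 + a3" "a2 + a3"] B0 B_self add_0_left,
        simp only: s_eq(3) B_add_right[of "b1 + b2" "_ + _ + _"] B_add_right[of "b1 + b2" "b1 + b2"] B0 B_self add_0_left,
        simp only: s_eq(2) B_add_right[of "b2 + b3" "_ + _ + _"] B_add_right[of "b2 + b3" "a2 + a3"] B0 B_self add_0_left)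
  have "B d (a2 + b2) = B d (a1 + a2) + B d (a1 + b1) + B d (b1 + b2)"
    "B d (a3 + b3) = B d (a2 + a3) + B d (a1 + a2) + B d (a1 + b1) + B d (b1 + b2) + B d (b2 + b3)"
    by (simp_all add: B_add_right ac_simps)
  then have d': "B d (a2 + b2) = 1" "B d (a3 + b3) = 1" using d by simp_all
  have ds: "B d s = 1" using d d' by (simp add: s_def B_add_right[of d "_ + _"])
  \<comment> \<open>The three summands of \<open>s\<close> are mutually orthogonal and each is
    nonorthogonal to \<open>d\<close>, so they can be added to \<open>d\<close> one after the
    other.\<close>
  have "d + (a1 + b1) \<in> D" using root_add d sums by blast
  moreover have "B (d + (a1 + b1)) (a2 + b2) = 1"
    using d' B0 by (simp add: B_add_left[of d])
  ultimately have "(d + (a1 + b1)) + (a2 + b2) \<in> D" using root_add sums by blast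
  moreover have "B ((d + (a1 + b1)) + (a2 + b2)) (a3 + b3) = 1"
    using d' B0 by (simp add: B_add_left[of "d + (a1 + b1)"] B_add_left[of d])
  ultimately have "((d + (a1 + b1)) + (a2 + b2)) + (a3 + b3) \<in> D" using root_add sums by blast
  then have dsD: "d + s \<in> D" by (simp add: s_def add.assoc)
  moreover have "B d (d + s) = 1" using ds by (simp add: B_add_right)
  ultimately have "d + (d + s) \<in> D" using root_add d(1) by blast
  then have sD: "s \<in> D" by simp
  define P1 where "P1 = {0, a1 + a2, a2 + a3, (a1 + a2) + (a2 + a3)}"
  define P2 where "P2 = {0, b1 + b2, b2 + b3, (b1 + b2) + (b2 + b3)}"
  define P3 where "P3 = {0, d, s, d + s}"
  have e: "(a1 + a2) + (a2 + a3) = a1 + a3" "(b1 + b2) + (b2 + b3) = b1 + b3" by (simp_all add: ac_simps)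
  have inD: "P1 - {0} \<subseteq> D" "P2 - {0} \<subseteq> D" "P3 - {0} \<subseteq> D"
    unfolding P1_def P2_def P3_def e using sums d(1) sD dsD by blast+
  have B1: "B (a1 + a2) (a2 + a3) = 1" "B (b1 + b2) (b2 + b3) = 1"
    using triangle_B[of a2 a1 a3] triangle_B[of b2 b1 b3] sums sums' by (simp_all only: add.commute[of a2 a1] add.commute[of b2 b1])
  have pl: "anisotropic_plane P1" "anisotropic_plane P2" "anisotropic_plane P3"
    unfolding P1_def P2_def P3_def
    by (intro anisotropic_planeI; use root_Q sums d(1) sD B1 ds in blast)+
  have o: "x \<in> P1 \<Longrightarrow> y \<in> P2 \<Longrightarrow> B x y = 0" "x \<in> P1 \<Longrightarrow> z \<in> P3 \<Longrightarrow> B x z = 0"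
    "y \<in> P2 \<Longrightarrow> z \<in> P3 \<Longrightarrow> B y z = 0" for x y z
  proof -
    define u1 u2 v1 v2 where uv: "u1 = a1 + a2" "u2 = a2 + a3" "v1 = b1 + b2" "v2 = b2 + b3"
    have "B u1 v1 = 0" "B u1 v2 = 0" "B u2 v1 = 0" "B u2 v2 = 0" "B u1 s = 0" "B u2 s = 0"
      "B v1 s = 0" "B v2 s = 0" "B u1 d = 0" "B u2 d = 0" "B v1 d = 0" "B v2 d = 0"
      unfolding uv using B0 sperp d by (simp_all add: B_sym[of _ d])
    then show "x \<in> P1 \<Longrightarrow> y \<in> P2 \<Longrightarrow> B x y = 0" "x \<in> P1 \<Longrightarrow> z \<in> P3 \<Longrightarrow> B x z = 0"
      "y \<in> P2 \<Longrightarrow> z \<in> P3 \<Longrightarrow> B y z = 0"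
      unfolding P1_def P2_def P3_def uv[symmetric] by (auto simp: form_simps)
  qed
  have "a2 + a3 \<noteq> 0" "b2 + b3 \<noteq> 0" "s \<noteq> 0" using sums sD root_Q by fastforce+
  \<comment> \<open>This is the root with three nonzero components from which
    \<open>three_planes\<close> starts.\<close>
  moreover have "(a2 + a3) + (b2 + b3) + s = a1 + b1"
    unfolding s_eq(2) by (simp add: ac_simps)
  ultimately obtain U where U: "additive_subgroup U" "card U = 64" "nondegenerate_on U" "a2 + a3 \<in> U"
    "\<And>u. u \<in> U \<Longrightarrow> Q u = 1 \<Longrightarrow> u \<in> D"
    using three_planes[OF pl(1) inD(1) pl(2) inD(2) pl(3) inD(3) o, of "a2 + a3" "b2 + b3" s] sums
    unfolding P1_def P2_def P3_def by auto
  show ?thesis using all_roots[OF U(1-3,5,4) sums(3)] by simp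
qed

subsection \<open>Cliques\<close>

text \<open>The elements themselves need not be roots; only differences matter, so a clique may be
  translated freely.\<close>

definition root_clique :: "'a set \<Rightarrow> bool"
  where "root_clique P \<longleftrightarrow> (\<forall>p\<in>P. \<forall>q\<in>P. p \<noteq> q \<longrightarrow> p + q \<in> D)"

definition maximum_clique :: "'a set \<Rightarrow> bool"
  where "maximum_clique P \<longleftrightarrow> root_clique P \<and> (\<forall>P'. root_clique P' \<longrightarrow> card P' \<le> card P)"

lemma root_nonzero: "x \<in> D \<Longrightarrow> x \<noteq> 0"
  using root_Q by fastforce

lemma clique_root: "root_clique P \<Longrightarrow> p \<in> P \<Longrightarrow> q \<in> P \<Longrightarrow> p \<noteq> q \<Longrightarrow> p + q \<in> D"
  by (simp add: root_clique_def)

lemma clique_B_1: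
  assumes "root_clique P" "p \<in> P" "q \<in> P" "r \<in> P" "p \<noteq> q" "p \<noteq> r" "q \<noteq> r"
  shows "B (p + q) (p + r) = 1"
  using assms by (intro triangle_B clique_root)

lemma clique_B_0:
  assumes "root_clique P" "p \<in> P" "q \<in> P" "r \<in> P" "t \<in> P" "p \<noteq> q" "p \<noteq> r" "p \<noteq> t" "q \<noteq> r" "q \<noteq> t"
  shows "B (p + q) (r + t) = 0"
  using assms by (intro square_B clique_root)

lemma orthogonal_roots_zero:
  assumes "\<And>d. d \<in> D \<Longrightarrow> B x d = 0"
  shows "x = 0"
proof -
  have "{v. B x v = 0} = UNIV"
    using assms by (intro roots_span) (auto simp: additive_subgroup_def B_add_right)
  then have "B x v = 0" for v by blast
  then show ?thesis by (rule nondegenerate)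
qed

text \<open>Two nonorthogonal roots span an anisotropic plane, which with 0 included is a clique of
  four elements.\<close>

lemma maximum_clique_exists:
  assumes "D \<noteq> {}"
  obtains P where "maximum_clique P" "4 \<le> card P"
proof -
  obtain P where P: "root_clique P" "\<And>P'. root_clique P' \<Longrightarrow> card P' \<le> card P"
    using ex_greatest_card[of root_clique "{}" "\<lambda>P. P"] by (auto simp: root_clique_def)
  obtain x where x: "x \<in> D" using assms by blast
  then obtain y where "y \<in> D" "B x y \<noteq> 0" using orthogonal_roots_zero[of x] root_nonzero by blast
  then have xy: "x \<in> D" "y \<in> D" "B x y = 1" using x by simp_all
  have "anisotropic_plane {0, x, y, x + y}" using anisotropic_planeI root_Q xy by blast
  then have "card {0, x, y, x + y} = 4" by (simp add: anisotropic_plane_def)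
  moreover have "root_clique {0, x, y, x + y}"
    using xy root_add[OF xy] by (auto simp: root_clique_def ac_simps)
  ultimately show ?thesis using that[of P] P by (metis maximum_clique_def)
qed

text \<open>If \<open>p\<close> were alone on its side, \<open>d\<close> would be nonorthogonal to
  all \<open>p + q\<close> with \<open>q\<close> in \<open>P\<close> other than \<open>p\<close>,
  and \<open>p + d\<close> could be added to the clique.\<close>

lemma maximum_clique_no_singleton:
  assumes P: "maximum_clique P" and d: "d \<in> D"
  shows "{q \<in> P. B d q = \<epsilon>} \<noteq> {p}"
proof
  assume S: "{q \<in> P. B d q = \<epsilon>} = {p}"
  have P': "root_clique P" using P by (simp add: maximum_clique_def)
  have p: "p \<in> P" "B d p = \<epsilon>" using S by auto
  have "p + d \<noteq> p" using root_nonzero[OF d] by simp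
  moreover have "B d (p + d) = \<epsilon>" using p by (simp add: B_add_right)
  ultimately have new: "p + d \<notin> P" using S by blast
  have "q + (p + d) \<in> D" if "q \<in> P" for q
  proof (cases "q = p")
    case False
    then have "B d q \<noteq> \<epsilon>" using S that by blast
    then have "B (p + q) d = 1"
      using p(2) by (cases \<epsilon>; cases "B d q") (simp_all add: B_sym[of _ d] B_add_right)
    then have "(p + q) + d \<in> D" using root_add clique_root[OF P' p(1) that] d False by blast
    then show ?thesis by (simp add: ac_simps)
  qed (use d in simp)
  then have "root_clique (insert (p + d) P)"
    using P' unfolding root_clique_def by (metis add.commute insert_iff)
  then have "card (insert (p + d) P) \<le> card P" using P by (simp add: maximum_clique_def)
  then show False using new by simp
qed

lemma three_distinct:
  assumes "3 \<le> card (A :: 'a set)"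
  obtains x y z where "x \<in> A" "y \<in> A" "z \<in> A" "x \<noteq> y" "x \<noteq> z" "y \<noteq> z"
proof -
  obtain T where "T \<subseteq> A" "card T = 3" using obtain_subset_with_card_n[OF assms] by metis
  then show ?thesis using that by (auto simp: card_3_iff)
qed

text \<open>With singletons excluded, a part of size below three is empty or a pair
  \<open>{p, q}\<close>. In the second case both \<open>d\<close> and \<open>p + q\<close> detect
  whether exactly one of \<open>r\<close>, \<open>t\<close> lies in the pair, so their sum is
  orthogonal to all differences.\<close>

lemma maximum_clique_decomposition:
  assumes P: "maximum_clique P" "4 \<le> card P" and noE6: "D \<noteq> {v. Q v = 1}" and d: "d \<in> D"
  shows "(\<forall>p\<in>P. \<forall>q\<in>P. B d (p + q) = 0) \<or>
    (\<exists>p\<in>P. \<exists>q\<in>P. p \<noteq> q \<and> (\<forall>r\<in>P. \<forall>t\<in>P. B (d + (p + q)) (r + t) = 0))"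
proof -
  have P': "root_clique P" using P by (simp add: maximum_clique_def)
  define A where "A \<epsilon> = {q \<in> P. B d q = \<epsilon>}" for \<epsilon>
  have not1: "card (A \<epsilon>) \<noteq> 1" for \<epsilon>
    using maximum_clique_no_singleton[OF P(1) d] by (auto simp: A_def card_1_singleton_iff)
  have "\<not> (3 \<le> card (A 0) \<and> 3 \<le> card (A 1))"
  proof
    assume c: "3 \<le> card (A 0) \<and> 3 \<le> card (A 1)"
    obtain a1 a2 a3 where a: "a1 \<in> A 0" "a2 \<in> A 0" "a3 \<in> A 0" "a1 \<noteq> a2" "a1 \<noteq> a3" "a2 \<noteq> a3"
      using three_distinct[OF conjunct1[OF c]] by blast
    obtain b1 b2 b3 where b: "b1 \<in> A 1" "b2 \<in> A 1" "b3 \<in> A 1" "b1 \<noteq> b2" "b1 \<noteq> b3" "b2 \<noteq> b3"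
      using three_distinct[OF conjunct2[OF c]] by blast
    note ab = a b
    then have ne: "a1 \<noteq> b1" "a1 \<noteq> b2" "a1 \<noteq> b3" "a2 \<noteq> b1" "a2 \<noteq> b2" "a2 \<noteq> b3"
      "a3 \<noteq> b1" "a3 \<noteq> b2" "a3 \<noteq> b3"
      by (auto simp: A_def)
    have "a1 \<in> P" "a2 \<in> P" "a3 \<in> P" "b1 \<in> P" "b2 \<in> P" "b3 \<in> P" using ab by (auto simp: A_def)
    then have "sorted_wrt (\<lambda>x y. x + y \<in> D) [a1, a2, a3, b1, b2, b3]"
      using ab ne by (auto intro!: clique_root[OF P'])
    then have "D = {v. Q v = 1}"
      using ab d by (intro E6_all_roots[of a1 a2 a3 b1 b2 b3 d]) (simp_all add: A_def B_add_right)
    then show False using noE6 by simp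
  qed
  moreover have "card P = card (A 0) + card (A 1)"
  proof -
    have "P = A 0 \<union> A 1" "A 0 \<inter> A 1 = {}" by (auto simp: A_def)
    then show ?thesis by (metis card_Un_disjoint finite_subset_space)
  qed
  ultimately have "card (A 0) = 0 \<or> card (A 1) = 0 \<or> card (A 0) = 2 \<or> card (A 1) = 2"
    using not1[of 0] not1[of 1] by linarith
  then obtain \<epsilon> where "card (A \<epsilon>) = 0 \<or> card (A \<epsilon>) = 2" by blast
  then show ?thesis
  proof
    assume "card (A \<epsilon>) = 0"
    then have "B d q = \<epsilon> + 1" if "q \<in> P" for q
      using that by (cases \<epsilon>) (auto simp: A_def)
    then show ?thesis by (simp add: B_add_right)
  next
    assume "card (A \<epsilon>) = 2"
    then obtain p q where pq: "A \<epsilon> = {p, q}" "p \<noteq> q" by (auto simp: card_2_iff)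
    then have pqP: "p \<in> P" "q \<in> P" by (auto simp: A_def)
    have Bd: "B d r = (if r \<in> {p, q} then \<epsilon> else \<epsilon> + 1)" if "r \<in> P" for r
    proof -
      have "r \<in> {p, q} \<longleftrightarrow> B d r = \<epsilon>" using that pq(1) by (auto simp flip: pq(1) simp: A_def)
      then show ?thesis by (cases \<epsilon>; cases "B d r") simp_all
    qed
    have Bpq: "B (p + q) (r + t) = (if (r \<in> {p, q}) = (t \<in> {p, q}) then 0 else 1)"
      if rt: "r \<in> P" "t \<in> P" for r t
    proof (cases "r = t")
      case False
      consider "r \<in> {p, q}" "t \<in> {p, q}" | "r \<notin> {p, q}" "t \<notin> {p, q}" | "r = p" "t \<notin> {p, q}"
        | "r = q" "t \<notin> {p, q}" | "t = p" "r \<notin> {p, q}" | "t = q" "r \<notin> {p, q}" by blast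
      then show ?thesis
      proof cases
        case 1
        then have "r + t = p + q" using False by (auto simp: add.commute)
        then show ?thesis using 1 by simp
      next
        case 2
        then show ?thesis using clique_B_0[OF P' pqP rt] pq(2) by auto
      next
        case 3
        then show ?thesis using clique_B_1[OF P' pqP rt(2)] pq(2) by auto
      next
        case 4
        then show ?thesis using clique_B_1[OF P' pqP(2,1) rt(2)] pq(2) by (auto simp: add.commute[of p q])
      next
        case 5
        then show ?thesis using clique_B_1[OF P' pqP rt(1)] pq(2) by (auto simp: add.commute[of r p])
      next
        case 6
        then show ?thesis using clique_B_1[OF P' pqP(2,1) rt(1)] pq(2)
          by (auto simp: add.commute[of p q] add.commute[of r q])
      qed
    qed simp
    have "B (d + (p + q)) (r + t) = 0" if "r \<in> P" "t \<in> P" for r t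
      using Bd[OF that(1)] Bd[OF that(2)] Bpq[OF that]
      by (simp add: B_add_left[of d] B_add_right[of d] split: if_splits)
    then show ?thesis using pqP pq(2) by blast
  qed
qed

section \<open>Roots shifted by a vector orthogonal to all clique differences\<close>

definition perp_differences :: "'a set \<Rightarrow> 'a \<Rightarrow> bool"
  where "perp_differences P c \<longleftrightarrow> (\<forall>r\<in>P. \<forall>t\<in>P. B c (r + t) = 0)"

text \<open>The shift \<open>c\<close> is invisible to the differences, so adding
  \<open>x + z\<close> to \<open>x + y + c\<close> moves one index as in type A. Two such moves
  reach any pair.\<close>

lemma shifted_roots:
  assumes P: "root_clique P" and c: "perp_differences P c"
    and pq: "p \<in> P" "q \<in> P" "p \<noteq> q" "p + q + c \<in> D"
    and rt: "r \<in> P" "t \<in> P" "r \<noteq> t"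
  shows "r + t + c \<in> D"
proof -
  have step: "y + z + c \<in> D"
    if "x \<in> P" "y \<in> P" "z \<in> P" "x \<noteq> y" "y \<noteq> z" "x + y + c \<in> D" for x y z
  proof (cases "z = x")
    case True
    then show ?thesis using that by (simp add: add.commute)
  next
    case False
    have "B c (x + z) = 0" using c that by (simp add: perp_differences_def)
    then have "B (x + y + c) (x + z) = 1"
      using clique_B_1[OF P that(1,2,3)] that False by (simp add: B_add_left[of "x + y"])
    then have "(x + y + c) + (x + z) \<in> D"
      using root_add that(6) clique_root[OF P that(1,3)] False by blast
    then show ?thesis by (simp add: ac_simps)
  qed
  have qp: "q + p + c \<in> D" using pq by (simp add: add.commute)
  show ?thesis
  proof (cases "r = p")
    case True
    then show ?thesis using step[OF pq(2,1) rt(2)] qp pq rt by auto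
  next
    case False
    then have "p + r + c \<in> D" using step[OF pq(2,1) rt(1)] qp pq by auto
    then show ?thesis using step[OF pq(1) rt(1,2)] False rt by auto
  qed
qed

text \<open>Connectedness provides a root \<open>y\<close> that is no clique difference but is
  nonorthogonal to one. The decomposition then gives \<open>c = y + (p + q)\<close>, which is
  nonzero precisely because \<open>y\<close> is not a difference.\<close>

lemma exists_shifted_root:
  assumes P: "maximum_clique P" "4 \<le> card P" and noE6: "D \<noteq> {v. Q v = 1}"
    and not_diff: "e \<in> D" "\<not> (\<exists>p\<in>P. \<exists>q\<in>P. p \<noteq> q \<and> e = p + q)"
  obtains p q c where "p \<in> P" "q \<in> P" "p \<noteq> q" "c \<noteq> 0" "perp_differences P c" "p + q + c \<in> D"
proof -
  have P': "root_clique P" using P by (simp add: maximum_clique_def)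
  define X where "X = {x. \<exists>p\<in>P. \<exists>q\<in>P. p \<noteq> q \<and> x = p + q}"
  have "X \<subseteq> D" using clique_root[OF P'] by (auto simp: X_def)
  moreover have "X \<noteq> {}"
  proof -
    have "3 \<le> card P" using P(2) by simp
    then obtain x y z where "x \<in> P" "y \<in> P" "x \<noteq> y" by (rule three_distinct)
    then show ?thesis by (auto simp: X_def)
  qed
  moreover have "X \<noteq> D" using not_diff by (auto simp: X_def)
  ultimately obtain x y where xy: "x \<in> X" "y \<in> D" "B x y = 1" "y \<notin> X"
    using roots_connected[of X] by blast
  then obtain p0 q0 where "p0 \<in> P" "q0 \<in> P" "B y (p0 + q0) = 1" by (auto simp: X_def B_sym[of _ y])
  then obtain p q where pq: "p \<in> P" "q \<in> P" "p \<noteq> q"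
    "\<forall>r\<in>P. \<forall>t\<in>P. B (y + (p + q)) (r + t) = 0"
    using maximum_clique_decomposition[OF P noE6 xy(2)] by force
  define c where "c = y + (p + q)"
  have "p + q + c \<in> D" using xy(2) by (simp add: c_def ac_simps)
  moreover have "perp_differences P c" using pq(4) by (simp only: perp_differences_def c_def)
  moreover have "c \<noteq> 0" using xy(4) pq add_eq_0_iff_eq[of y "p + q"] by (auto simp: c_def X_def)
  ultimately show ?thesis using that pq(1-3) by blast
qed

text \<open>The sum is orthogonal to every root: if \<open>d\<close> is not orthogonal to all
  differences, \<open>d + (p + q)\<close> is, and \<open>p + q\<close> is orthogonal to the
  complementary difference \<open>r + t\<close>.\<close>

lemma four_clique_sum:
  assumes P: "maximum_clique P" "card P = 4" and noE6: "D \<noteq> {v. Q v = 1}"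
  shows "\<Sum>P = 0"
proof (rule orthogonal_roots_zero)
  have P': "root_clique P" using P by (simp add: maximum_clique_def)
  have split: "\<exists>r t. r \<in> P \<and> t \<in> P \<and> r \<noteq> t \<and> r \<noteq> p \<and> t \<noteq> p \<and> r \<noteq> q \<and> t \<noteq> q \<and> \<Sum>P = (p + q) + (r + t)"
    if "p \<in> P" "q \<in> P" "p \<noteq> q" for p q
  proof -
    have "card (P - {p, q}) = 2" using that P(2) by (simp add: card_Diff_subset)
    then obtain r t where rt: "P - {p, q} = {r, t}" "r \<noteq> t" by (auto simp: card_2_iff)
    have "P = insert p (insert q (P - {p, q}))" using that by auto
    then have Peq: "P = {p, q, r, t}" using rt(1) by simp
    have "\<Sum>{p, q, r, t} = (p + q) + (r + t)" using that(3) rt by (subst sum.insert; force simp: add.assoc)+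
    then have "\<Sum>P = (p + q) + (r + t)" using Peq by simp
    then show ?thesis using rt by blast
  qed
  fix d assume d: "d \<in> D"
  have perp: "B c (\<Sum>P) = 0" if "\<And>r t. r \<in> P \<Longrightarrow> t \<in> P \<Longrightarrow> B c (r + t) = 0" for c
  proof -
    have "3 \<le> card P" using P(2) by simp
    then obtain p q z where pq: "p \<in> P" "q \<in> P" "p \<noteq> q" by (rule three_distinct)
    then obtain r t where "r \<in> P" "t \<in> P" "\<Sum>P = (p + q) + (r + t)" using split by blast
    then show ?thesis using that pq by (simp add: B_add_right[of c "p + q"])
  qed
  show "B (\<Sum>P) d = 0"
  proof (cases "\<forall>p\<in>P. \<forall>q\<in>P. B d (p + q) = 0")
    case True
    then show ?thesis using perp[of d] by (simp add: B_sym)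
  next
    case False
    then obtain p q where pq: "p \<in> P" "q \<in> P" "p \<noteq> q"
      "\<forall>r\<in>P. \<forall>t\<in>P. B (d + (p + q)) (r + t) = 0"
      using maximum_clique_decomposition[OF P(1) _ noE6 d] P(2) by auto
    obtain r t where rt: "r \<in> P" "t \<in> P" "r \<noteq> t" "r \<noteq> p" "t \<noteq> p" "r \<noteq> q" "t \<noteq> q"
      "\<Sum>P = (p + q) + (r + t)" using split[OF pq(1-3)] by blast
    have "B (p + q) (\<Sum>P) = 0"
      using clique_B_0[OF P' pq(1,2) rt(1,2)] rt pq(3) by (simp add: B_add_right[of _ "p + q"])
    moreover have "B (d + (p + q)) (\<Sum>P) = 0" using perp pq(4) by blast
    ultimately show ?thesis by (simp add: B_add_left[of d] B_sym[of _ d])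
  qed
qed

text \<open>The shifted roots \<open>p + q + c\<close> are ruled out as follows: for \<open>card P = 4\<close> they produce
  another maximum clique, whose sum is \<open>c\<close>; for \<open>card P \<ge> 5\<close> they produce an \<open>E\<^sub>6\<close>
  configuration.\<close>

lemma roots_are_clique_differences:
  assumes "D \<noteq> {}" and noE6: "D \<noteq> {v. Q v = 1}"
  obtains P where "root_clique P" "\<And>d. d \<in> D \<Longrightarrow> \<exists>p\<in>P. \<exists>q\<in>P. p \<noteq> q \<and> d = p + q"
proof -
  obtain P where P: "maximum_clique P" "4 \<le> card P" using maximum_clique_exists assms(1) by blast
  have P': "root_clique P" using P by (simp add: maximum_clique_def)
  have "\<exists>p\<in>P. \<exists>q\<in>P. p \<noteq> q \<and> e = p + q" if "e \<in> D" for e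
  proof (rule ccontr)
    assume "\<not> ?thesis"
    then obtain p q c where pq: "p \<in> P" "q \<in> P" "p \<noteq> q"
      and c: "c \<noteq> 0" "perp_differences P c" "p + q + c \<in> D"
      using exists_shifted_root[OF P noE6 \<open>e \<in> D\<close>] by blast
    have shift: "r + t + c \<in> D" if "r \<in> P" "t \<in> P" "r \<noteq> t" for r t
      using shifted_roots[OF P' c(2) pq c(3) that] .
    show False
    proof (cases "card P = 4")
      case True
      have "\<not> P \<subseteq> {p, q}"
      proof
        assume "P \<subseteq> {p, q}"
        then have "card P \<le> card {p, q}" by (intro card_mono) auto
        then show False using P(2) pq(3) by simp
      qed
      then obtain r where r: "r \<in> P" "r \<noteq> p" "r \<noteq> q" by blast
      \<comment> \<open>Translated by \<open>r\<close>, the given clique is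
        \<open>{0, p + r, q + r, p + q}\<close>, as its sum vanishes. Here the last element is
        shifted by \<open>c\<close>; a vanishing sum for the new clique forces
        \<open>c = 0\<close>.\<close>
      let ?P = "{0, p + r, q + r, p + q + c}"
      have D: "p + r \<in> D" "q + r \<in> D" "p + q \<in> D" "p + r + c \<in> D" "q + r + c \<in> D"
        using clique_root[OF P'] shift pq r by auto
      have eqs: "(p + r) + (q + r) = p + q" "(p + r) + (p + q + c) = q + r + c"
        "(q + r) + (p + q + c) = p + r + c"
        by (simp_all add: ac_simps)
      have ne: "p + r \<noteq> q + r" "p + r \<noteq> p + q + c" "q + r \<noteq> p + q + c"
        using eqs D root_nonzero add_self by metis+
      have "root_clique ?P"
        using D c(3) eqs eqs[unfolded add.commute[of "p + r"]] eqs[unfolded add.commute[of "q + r"]]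
        unfolding root_clique_def by (auto simp only: insert_iff empty_iff add_0_left add_0_right)
      moreover have "card ?P = 4"
        using ne D(1,2)[THEN root_nonzero] root_nonzero[OF c(3)] by (simp add: card_insert_if)
      ultimately have "maximum_clique ?P" using P True by (simp add: maximum_clique_def)
      then have "\<Sum>?P = 0" using four_clique_sum \<open>card ?P = 4\<close> noE6 by blast
      moreover have "\<Sum>?P = c"
        using ne D(1,2) c(3) root_nonzero by (subst sum.insert; force simp: ac_simps)+
      ultimately show False using c(1) by simp
    next
      case False
      then have "5 \<le> card P" using P(2) by linarith
      then obtain T where "T \<subseteq> P" "card T = 5" using obtain_subset_with_card_n by metis
      moreover obtain xs where "set xs = T" "distinct xs"
        using finite_distinct_list[OF finite_subset_space] by blast
      ultimately have xs: "set xs \<subseteq> P" "distinct xs" "length xs = 5" using distinct_card[of xs] by auto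
      then obtain p1 p2 p3 p4 p5 where "xs = [p1, p2, p3, p4, p5]"
        by (auto simp: length_Suc_conv eval_nat_numeral)
      then have p: "p1 \<in> P" "p2 \<in> P" "p3 \<in> P" "p4 \<in> P" "p5 \<in> P"
        and dist: "distinct [p1, p2, p3, p4, p5]"
        using xs by simp_all
      obtain e where e: "e \<in> D" "B c e = 1"
        using orthogonal_roots_zero[of c] c(1) by (metis bit_not_zero_iff)
      \<comment> \<open>Replacing \<open>e\<close> by \<open>e + (r + t)\<close> makes it orthogonal
        to the differences. Adding \<open>c\<close> as well keeps it a root and does not affect the
        product with \<open>c\<close>.\<close>
      have "\<exists>d\<in>D. perp_differences P d \<and> B c d = 1"
      proof (cases "perp_differences P e")
        case True
        then show ?thesis using e by blast
      next
        case False
        then obtain r t where rt: "r \<in> P" "t \<in> P" "r \<noteq> t"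
          and c': "\<forall>x\<in>P. \<forall>y\<in>P. B (e + (r + t)) (x + y) = 0"
          using maximum_clique_decomposition[OF P noE6 e(1)] by (auto simp: perp_differences_def)
        define d where "d = e + (r + t + c)"
        have "B (e + (r + t)) (r + t) = 0" using c' rt by blast
        then have "B e (r + t) = 0" by (simp add: B_add_left[of e])
        then have "B e (r + t + c) = 1"
          using e(2) by (simp add: B_add_right[of e "r + t"] B_sym[of e c])
        then have "d \<in> D" unfolding d_def using root_add e(1) shift[OF rt] by blast
        moreover have "d = (e + (r + t)) + c" by (simp add: d_def ac_simps)
        then have "perp_differences P d"
          using c' c(2) by (simp add: perp_differences_def B_add_left[of "e + (r + t)"])
        moreover have "B c (r + t) = 0" using c(2) rt by (simp add: perp_differences_def)
        then have "B c d = 1" using e(2) by (simp add: d_def B_add_right[of c e] B_add_right[of c "r + t"])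
        ultimately show ?thesis by blast
      qed
      then obtain d where d: "d \<in> D" "perp_differences P d" "B c d = 1" by blast
      have shift2: "(r + t + c) + d \<in> D" if "r \<in> P" "t \<in> P" "r \<noteq> t" for r t
      proof -
        have "B d (r + t) = 0" using d(2) that by (simp add: perp_differences_def)
        then have "B (r + t + c) d = 1"
          using d(3) by (simp add: B_sym[of _ d] B_add_right[of d "r + t"])
        then show ?thesis using root_add shift[OF that] d(1) by blast
      qed
      \<comment> \<open>Two substitutes for \<open>p1\<close>, differing by the root
        \<open>d\<close>. They form a clique of six with \<open>p2\<close>, ..., \<open>p5\<close>,
        and the root \<open>p1 + p2\<close> splits it into \<open>{a, b, p2}\<close> and
        \<open>{p3, p4, p5}\<close>.\<close>
      define a b where "a = p1 + c + d" "b = p1 + c"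
      note a_def = this(1) and b_def = this(2)
      have eqs: "a + b = d" "a + x = (p1 + x + c) + d"
        "b + x = p1 + x + c" for x
        by (simp_all add: a_def b_def ac_simps)
      have "a + b \<in> D" using d(1) by (simp only: eqs(1))
      moreover have "a + x \<in> D" "b + x \<in> D" if "x \<in> P" "p1 \<noteq> x" for x
        using shift[OF p(1) that(1)] shift2[OF p(1) that(1)] that(2) unfolding eqs(2,3) by auto
      ultimately have "sorted_wrt (\<lambda>x y. x + y \<in> D) [a, b, p2, p3, p4, p5]"
        using p dist clique_root[OF P'] by simp
      moreover have "B (p1 + p2) (b + p2) = 0"
        using c(2) p by (simp add: eqs(3) B_add_right[of _ "p1 + p2"] B_sym[of _ c] perp_differences_def)
      moreover have "B (p1 + p2) (a + b) = 0"
        using d(2) p by (simp add: eqs(1) B_sym[of _ d] perp_differences_def)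
      moreover have "B (p1 + p2) (p3 + p4) = 0" "B (p1 + p2) (p4 + p5) = 0"
        using clique_B_0[OF P'] p dist by simp_all
      moreover have "B (p1 + p2) (a + p3) = 1"
      proof -
        have "B (p1 + p2) c = 0" "B (p1 + p2) d = 0"
          using c(2) d(2) p by (simp_all add: B_sym[of "p1 + p2"] perp_differences_def)
        moreover have "B (p1 + p2) (p1 + p3) = 1"
          using clique_B_1[OF P', of p1 p2 p3] p dist by simp
        ultimately show ?thesis
          by (simp add: eqs(2) B_add_right[of _ "p1 + p3 + c"] B_add_right[of _ "p1 + p3"])
      qed
      moreover have "p1 + p2 \<in> D" using clique_root[OF P'] p dist by simp
      ultimately have "D = {v. Q v = 1}"
        by (intro E6_all_roots[of a b p2 p3 p4 p5 "p1 + p2"])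
      then show False using noE6 by simp
    qed
  qed
  then show ?thesis using that P' by blast
qed

text \<open>For nonorthogonal roots \<open>z\<close> and \<open>t\<close>, the transvection in the
  root \<open>z + t\<close> takes \<open>z\<close> to \<open>t\<close>; connectedness does the
  rest.\<close>

lemma roots_transitive:
  assumes "x \<in> D" "y \<in> D"
  shows "\<exists>w\<in>transvection_group D. w x = y"
proof -
  define X where "X = {z \<in> D. \<exists>w\<in>transvection_group D. w x = z}"
  have "X = D"
  proof (rule roots_connected)
    show "X \<subseteq> D" by (auto simp: X_def)
    show "X \<noteq> {}" using assms(1) transvection_group.id by (force simp: X_def)
    fix z t assume "z \<in> X" and t: "t \<in> D" "B z t = 1"
    then obtain w where w: "w \<in> transvection_group D" "w x = z" "z \<in> D" by (auto simp: X_def)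
    then have "z + t \<in> D" using root_add t by blast
    then have "transvection (z + t) \<circ> w \<in> transvection_group D"
      using w(1) by (rule transvection_group.step)
    moreover have "(transvection (z + t) \<circ> w) x = t"
      using w t by (simp add: transvection_def B_add_left B_sym[of t z])
    ultimately show "t \<in> X" using t(1) unfolding X_def by blast
  qed
  then show ?thesis using assms(2) by (auto simp: X_def)
qed

end

section \<open>The lit-only game on a graph\<close>

text \<open>As \<open>x + y\<close> is the image of \<open>y\<close> under the transvection in
  \<open>x\<close>, this is the orbit of the simple roots under the group that their transvections
  generate.\<close>

inductive_set roots :: "'s::finite set set \<Rightarrow> (bit^'s) set" for R
  where simple: "simple_root s \<in> roots R"
  | sum: "x \<in> roots R \<Longrightarrow> y \<in> roots R \<Longrightarrow> bform R x y = 1 \<Longrightarrow> x + y \<in> roots R"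

lemma finite_bit_vec: "finite (UNIV :: (bit^'s::finite) set)"
proof -
  have "(UNIV :: (bit^'s) set) \<subseteq> (\<lambda>A. \<chi> s. if s \<in> A then 1 else 0) ` UNIV"
  proof
    fix v :: "bit^'s"
    have "v = (\<chi> s. if s \<in> {s. v $ s = 1} then 1 else 0)" by (simp add: vec_eq_iff)
    then show "v \<in> (\<lambda>A. \<chi> s. if s \<in> A then 1 else 0) ` UNIV" by blast
  qed
  then show ?thesis by (rule finite_subset) simp
qed

lemma quadratic_space_graph:
  fixes R :: "'s::finite set set"
  assumes "simple_graph UNIV R" "nondegenerate_graph R"
  shows "quadratic_space (bform R) (qform R)"
proof
  show "finite (UNIV :: (bit^'s) set)" by (rule finite_bit_vec)
  show "x + x = 0" for x :: "bit^'s" by (simp add: vec_eq_iff)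
  show "bform R (x + y) z = bform R x z + bform R y z" for x y z by (rule bform_add_left)
  show "qform R (x + y) = qform R x + qform R y + bform R x y" for x y
    using is_qform_qform[OF assms(1)] by (simp add: is_qform_def)
  show "x = 0" if "\<And>y. bform R x y = 0" for x
    using assms(2) that by (simp add: nondegenerate_graph_def)
qed

lemma simple_roots_span:
  fixes M :: "(bit^'s::finite) set"
  assumes M: "additive_subgroup M" "\<And>s. simple_root s \<in> M"
  shows "M = UNIV"
proof -
  have "v \<in> M" for v
  proof -
    have "c *s simple_root s \<in> M" for c s
      using M by (cases c) (auto simp: additive_subgroup_def)
    then have "(\<Sum>s\<in>A. (v $ s) *s simple_root s) \<in> M" for A
      using M(1) by (induction A rule: infinite_finite_induct) (simp_all add: additive_subgroup_def)
    from this[of UNIV] show ?thesis by (simp add: basis_expansion)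
  qed
  then show ?thesis by auto
qed

text \<open>Connectedness passes from the graph to the roots because a sum \<open>x + y\<close> of
  nonorthogonal roots is nonorthogonal to \<open>x\<close>. This leads from any root down to a
  simple one and back up again.\<close>

lemma root_system_graph:
  fixes R :: "'s::finite set set"
  assumes "simple_graph UNIV R" "connected_graph UNIV R" "nondegenerate_graph R"
  shows "root_system (bform R) (qform R) (roots R)"
proof -
  interpret quadratic_space "bform R" "qform R"
    using quadratic_space_graph assms by blast
  show ?thesis
  proof
    show "qform R x = 1" if "x \<in> roots R" for x
      using that
    proof induction
      case (simple s)
      then show ?case using is_qform_qform[OF assms(1)] by (simp add: is_qform_def)
    qed (simp add: Q_add)
    show "x + y \<in> roots R" if "x \<in> roots R" "y \<in> roots R" "bform R x y = 1" for x y
      using that by (rule roots.sum)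
    show "M = UNIV" if "additive_subgroup M" "roots R \<subseteq> M" for M
      using simple_roots_span[OF that(1)] that(2) roots.simple by blast
    fix X assume X: "X \<subseteq> roots R" "X \<noteq> {}"
      and closed: "\<And>x y. x \<in> X \<Longrightarrow> y \<in> roots R \<Longrightarrow> bform R x y = 1 \<Longrightarrow> y \<in> X"
    have "\<exists>s. simple_root s \<in> X" if "x \<in> roots R" "x \<in> X" for x
      using that
    proof induction
      case (sum x y)
      have "bform R (x + y) x = 1" using sum by (simp add: form_simps B_sym[of y x])
      then show ?case using sum closed by blast
    qed blast
    then obtain s0 where s0: "simple_root s0 \<in> X" using X by blast
    have base: "simple_root t \<in> X" for t
    proof -
      have "(s0, t) \<in> {(u, v). u \<in> UNIV \<and> v \<in> UNIV \<and> {u, v} \<in> R}\<^sup>*"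
        using assms(2) by (simp add: connected_graph_def)
      then show ?thesis
      proof induction
        case (step u v)
        then show ?case using closed[of "simple_root u" "simple_root v"]
          by (simp add: bform_simple_root roots.simple)
      qed (rule s0)
    qed
    have sum_closed: "x + y \<in> X" if "x \<in> X" "y \<in> X" "bform R x y = 1" for x y
    proof (rule closed[OF that(1)])
      show "x + y \<in> roots R" using that X by (auto intro: roots.sum)
      show "bform R x (x + y) = 1" using that by (simp add: B_add_right)
    qed
    have "x \<in> X" if "x \<in> roots R" for x
      using that by induction (use base sum_closed in auto)
    then show "X = roots R" using X by blast
  qed
qed

section \<open>Line graphs and the existence of singular vectors\<close>

text \<open>Vertex \<open>s\<close> becomes the edge \<open>{f s, g s}\<close>. Distinct vertices
  give distinct edges, since the simple root is the sum of the endpoints; distinct edges that meet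
  share exactly one endpoint, which is when the form takes the value 1.\<close>

lemma line_graph_of_clique:
  fixes R :: "'s::finite set set"
  assumes R: "simple_graph UNIV R" and RS: "root_system (bform R) (qform R) (roots R)"
    and P: "root_system.root_clique (roots R) P"
    and diff: "\<And>s. \<exists>p\<in>P. \<exists>q\<in>P. p \<noteq> q \<and> simple_root s = p + q"
  shows "is_line_graph UNIV R"
proof -
  interpret root_system "bform R" "qform R" "roots R" by (rule RS)
  obtain f g where fg: "\<And>s. f s \<in> P" "\<And>s. g s \<in> P" "\<And>s. f s \<noteq> g s" "\<And>s. simple_root s = f s + g s"
    using diff by metis
  define \<phi> where "\<phi> s = {f s, g s}" for s
  have inj: "\<phi> s = \<phi> t \<Longrightarrow> s = t" for s t
  proof -
    assume "\<phi> s = \<phi> t"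
    then have "f s + g s = f t + g t" by (auto simp: \<phi>_def doubleton_eq_iff add.commute)
    then have "simple_root s = (simple_root t :: bit^'s)" using fg(4) by metis
    then show "s = t" by (auto simp: axis_eq_axis)
  qed
  have adj: "{s, t} \<in> R \<longleftrightarrow> \<phi> s \<inter> \<phi> t \<noteq> {}" if st: "s \<noteq> t" for s t
  proof -
    have R_iff: "{s, t} \<in> R \<longleftrightarrow> bform R (f s + g s) (f t + g t) = 1"
      using bform_simple_root[of R s t] by (simp flip: fg(4))
    show ?thesis
    proof (cases "\<phi> s \<inter> \<phi> t = {}")
      case True
      then have "bform R (f s + g s) (f t + g t) = 0"
        using fg(3) by (intro clique_B_0[OF P fg(1) fg(2) fg(1) fg(2)]) (auto simp: \<phi>_def)
      then show ?thesis using R_iff True by simp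
    next
      case False
      have B1: "bform R (p + q) (p + r) = 1" if "p \<in> P" "q \<in> P" "r \<in> P" "p \<noteq> q" "p \<noteq> r" "q \<noteq> r" for p q r
        using clique_B_1[OF P that] .
      have ne: "\<phi> s \<noteq> \<phi> t" using inj st by blast
      from False consider "f s = f t" | "f s = g t" | "g s = f t" | "g s = g t" by (auto simp: \<phi>_def)
      then have "bform R (f s + g s) (f t + g t) = 1"
      proof cases
        case 1
        then have "g s \<noteq> g t" using ne by (auto simp: \<phi>_def)
        then show ?thesis using 1 B1[OF fg(1)[of s] fg(2)[of s] fg(2)[of t]] fg(3)[of s] fg(3)[of t] by simp
      next
        case 2
        then have "g s \<noteq> f t" using ne by (auto simp: \<phi>_def)
        then show ?thesis using 2 B1[OF fg(1)[of s] fg(2)[of s] fg(1)[of t]] fg(3)[of s] fg(3)[of t]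
          by (simp add: add.commute)
      next
        case 3
        then have "f s \<noteq> g t" using ne by (auto simp: \<phi>_def)
        then show ?thesis using 3 B1[OF fg(2)[of s] fg(1)[of s] fg(2)[of t]] fg(3)[of s] fg(3)[of t]
          by (simp add: add.commute)
      next
        case 4
        then have "f s \<noteq> f t" using ne by (auto simp: \<phi>_def)
        then show ?thesis using 4 B1[OF fg(2)[of s] fg(1)[of s] fg(1)[of t]] fg(3)[of s] fg(3)[of t]
          by (simp add: add.commute)
      qed
      then show ?thesis using R_iff False by simp
    qed
  qed
  have "graph_iso UNIV R (range \<phi>) (line_graph_edges (range \<phi>))"
    unfolding graph_iso_def
  proof (intro exI conjI ballI)
    show "bij_betw \<phi> UNIV (range \<phi>)" using inj by (auto simp: bij_betw_def inj_def)
    fix s t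
    have "{s} \<notin> R" using R by (auto simp: simple_graph_def)
    then show "{s, t} \<in> R \<longleftrightarrow> {\<phi> s, \<phi> t} \<in> line_graph_edges (range \<phi>)"
      using adj[of s t] inj[of s t] line_graph_edges_iff[of "\<phi> s" "\<phi> t" "range \<phi>"]
      by (cases "s = t") auto
  qed
  moreover have "simple_graph P (range \<phi>)"
    using fg(1-3) by (auto simp: simple_graph_def \<phi>_def card_insert_if)
  ultimately show ?thesis by (intro is_line_graphI) auto
qed

lemma roots_eq_nonsingular:
  fixes R :: "'s::finite set set"
  assumes R: "simple_graph UNIV R" and RS: "root_system (bform R) (qform R) (roots R)"
    and L: "\<not> is_line_graph UNIV R"
  shows "roots R = {v. qform R v = 1}"
proof (rule ccontr)
  interpret root_system "bform R" "qform R" "roots R" by (rule RS)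
  assume "roots R \<noteq> {v. qform R v = 1}"
  moreover have "roots R \<noteq> {}" using roots.simple by blast
  ultimately obtain P where "root_clique P"
    "\<And>d. d \<in> roots R \<Longrightarrow> \<exists>p\<in>P. \<exists>q\<in>P. p \<noteq> q \<and> d = p + q"
    using roots_are_clique_differences by metis
  then show False using line_graph_of_clique[OF R RS] L roots.simple by metis
qed

text \<open>In an anisotropic space every nonzero vector would be a root, so the whole space would
  be a clique and the graph a line graph. The middle orbit of the theorem is therefore not
  empty.\<close>

lemma exists_singular:
  fixes R :: "'s::finite set set"
  assumes R: "simple_graph UNIV R" and RS: "root_system (bform R) (qform R) (roots R)"
    and L: "\<not> is_line_graph UNIV R"
  shows "\<exists>v. v \<noteq> 0 \<and> qform R v = 0"
proof (rule ccontr)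
  interpret root_system "bform R" "qform R" "roots R" by (rule RS)
  assume "\<not> ?thesis"
  then have "v \<in> roots R" if "v \<noteq> 0" for v
    using roots_eq_nonsingular[OF assms] that by auto
  then have "root_clique UNIV" by (auto simp: root_clique_def add_eq_0_iff_eq)
  moreover have "\<exists>p\<in>UNIV. \<exists>q\<in>UNIV. p \<noteq> q \<and> simple_root s = (p + q :: bit^'s)" for s
    using root_nonzero[OF roots.simple, of s] by (intro bexI[of _ 0] bexI[of _ "simple_root s"]) auto
  ultimately show False using line_graph_of_clique[OF R RS] L by blast
qed

section \<open>Transfer to the dual space\<close>

lemma dual_eqI:
  assumes "\<And>s. dual_apply f (simple_root s) = dual_apply g (simple_root s)"
  shows "f = g"
proof -
  have lin: "dual_apply h (u + v) = dual_apply h u + dual_apply h v" for h :: "'a dual" and u v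
    using linear_functional_iff[THEN iffD1, OF CollectD[OF dual_apply[of h]]] by blast
  have zero: "dual_apply h 0 = 0" for h :: "'a dual"
    using lin[of h 0 0] by simp
  have "{v. dual_apply f v = dual_apply g v} = UNIV"
    using assms by (intro simple_roots_span) (auto simp: additive_subgroup_def lin zero)
  then have "dual_apply f = dual_apply g" by auto
  then show ?thesis by (simp add: dual_apply_inject)
qed

lemma theta_add: "\<theta> R (u + v) = \<theta> R u + \<theta> R v"
  by transfer (simp add: bform_add_left fun_eq_iff)

text \<open>Surjectivity is obtained by counting: evaluation on the basis embeds the dual space into
  the finite space \<open>bit^'s\<close>, where an injective self-map is surjective.\<close>

lemma bij_theta:
  fixes R :: "'s::finite set set"
  assumes "nondegenerate_graph R"
  shows "bij (\<theta> R)"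
proof -
  define j :: "'s dual \<Rightarrow> bit^'s" where "j f = (\<chi> s. dual_apply f (simple_root s))" for f
  have j: "inj j" by (rule injI) (auto simp: j_def vec_eq_iff intro: dual_eqI)
  have inj: "inj (\<theta> R)"
  proof (rule injI)
    fix u v assume "\<theta> R u = \<theta> R v"
    then have "bform R u w = bform R v w" for w by (metis \<theta>.rep_eq)
    then have "bform R (u + v) w = 0" for w by (simp add: bform_add_left)
    then have "u + v = 0" using assms by (simp add: nondegenerate_graph_def)
    moreover have "v + v = 0" by (simp add: vec_eq_iff)
    ultimately show "u = v" by (metis add_right_cancel)
  qed
  then have s: "surj (j \<circ> \<theta> R)" using j finite_bit_vec by (intro finite_UNIV_inj_surj inj_compose)
  have "\<exists>v. f = \<theta> R v" for f
  proof -
    obtain v where "j f = j (\<theta> R v)" using surjD[OF s, of "j f"] by auto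
    then show ?thesis using injD[OF j] by blast
  qed
  then have "surj (\<theta> R)" by (simp add: surj_def)
  then show ?thesis using inj by (simp add: bij_def)
qed

lemma theta_simple_root:
  "\<theta> R (simple_root s) = (\<Sum>t | {s, t} \<in> R. dual_basis t)"
proof (rule dual_eqI)
  fix u
  have app_sum: "dual_apply (\<Sum>t\<in>A. dual_basis t) v = (\<Sum>t\<in>A. v $ t)" for A and v :: "bit^'a"
    by (induction A rule: infinite_finite_induct)
      (simp_all add: zero_dual.rep_eq plus_dual.rep_eq dual_basis.rep_eq)
  show "dual_apply (\<theta> R (simple_root s)) (simple_root u) =
      dual_apply (\<Sum>t | {s, t} \<in> R. dual_basis t) (simple_root u)"
    unfolding app_sum \<theta>.rep_eq bform_simple_root by (simp add: axis_def)
qed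

lemma transvection_group_simple_roots:
  fixes R :: "'s::finite set set"
  assumes "quadratic_space (bform R) (qform R)"
  shows "quadratic_space.transvection_group (bform R) (range simple_root) =
    quadratic_space.transvection_group (bform R) (roots R)"
proof -
  interpret quadratic_space "bform R" "qform R" by (rule assms)
  have "transvection x \<in> transvection_group (range simple_root)" if "x \<in> roots R" for x
    using that
  proof induction
    case (simple s)
    then show ?case by (intro transvection_group_gen) simp
  next
    case (sum x y)
    then show ?case
      unfolding transvection_transvection[OF sum.hyps(3)] by (intro transvection_group_comp)
  qed
  then show ?thesis
    by (intro equalityI transvection_group_subset)
      (auto intro: transvection_group_gen roots.simple)
qed

lemma carrier_orthogonal_group:
  fixes R :: "'s::finite set set"
  assumes RS: "root_system (bform R) (qform R) (roots R)"
    and D: "roots R = {v. qform R v = 1}"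
  shows "carrier (orthogonal_group R) = quadratic_space.transvection_group (bform R) (roots R)"
proof -
  interpret root_system "bform R" "qform R" "roots R" by (rule RS)
  have "\<sigma> \<in> transvection_group (roots R)" if "\<sigma> \<in> carrier (orthogonal_group R)" for \<sigma>
  proof -
    have \<sigma>: "\<sigma> (u + v) = \<sigma> u + \<sigma> v" "qform R (\<sigma> v) = qform R v" for u v
      using that by (simp_all add: orthogonal_group_def GL_def Vector_Spaces.linear_iff)
    have "\<sigma> \<in> transvection_group {v. qform R v = 1}"
    proof (rule orthogonal_generated_by_transvections[OF \<sigma>])
      show "qform R (simple_root undefined) = 1" by (intro root_Q roots.simple)
    qed (use roots_transitive D in auto)
    then show ?thesis using D by simp
  qed
  moreover have "w \<in> carrier (orthogonal_group R)" if w: "w \<in> transvection_group (roots R)" for w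
  proof -
    have "w (c *s v) = c *s w v" for c v
      using transvection_group_add[OF w, of 0 0] by (cases c) simp_all
    then have "Vector_Spaces.linear (*s) (*s) w"
      using transvection_group_add[OF w] by (simp add: Vector_Spaces.linear_iff vec.vector_space_axioms)
    then show ?thesis
      using transvection_group_bij[OF w] transvection_group_Q[OF w] root_Q
      by (simp add: orthogonal_group_def GL_def)
  qed
  ultimately show ?thesis by blast
qed

text \<open>The sum over the neighbours of \<open>s\<close> is
  \<open>\<theta> R (simple_root s)\<close>, and the coefficient is the form of \<open>v\<close>
  with \<open>simple_root s\<close>; so the move is the transported transvection.\<close>

lemma kappa_theta:
  fixes R :: "'s::finite set set"
  assumes "quadratic_space (bform R) (qform R)"
  shows "\<kappa> R s (\<theta> R v) = \<theta> R (quadratic_space.transvection (bform R) (simple_root s) v)"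
proof -
  interpret quadratic_space "bform R" "qform R" by (rule assms)
  have "dual_scale 0 f = 0" "dual_scale 1 f = f" for f :: "'s dual"
    by (transfer, simp)+
  then show ?thesis
    by (cases "bform R v (simple_root s)")
      (simp_all add: \<kappa>_def \<theta>.rep_eq transvection_def theta_add B_sym[of _ v] flip: theta_simple_root)
qed

lemma carrier_flipping_group:
  fixes R :: "'s::finite set set"
  assumes R: "simple_graph UNIV R" and nd: "nondegenerate_graph R"
  shows "carrier (flipping_group R) = (\<lambda>w. \<theta> R \<circ> w \<circ> inv_into UNIV (\<theta> R)) `
    quadratic_space.transvection_group (bform R) (range simple_root)"
proof -
  have QS: "quadratic_space (bform R) (qform R)" using R nd by (rule quadratic_space_graph)
  interpret quadratic_space "bform R" "qform R" by (rule QS)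
  let ?G = "GL (dual_scale :: bit \<Rightarrow> 's dual \<Rightarrow> 's dual)"
  let ?W = "transvection_group (range simple_root)"
  let ?c = "\<lambda>w. \<theta> R \<circ> w \<circ> inv_into UNIV (\<theta> R)"
  have G: "group ?G" by (rule group_GL[OF vector_space_dual])
  have bij: "bij (\<theta> R)" using nd by (rule bij_theta)
  then have inv: "\<theta> R (inv_into UNIV (\<theta> R) f) = f" "inv_into UNIV (\<theta> R) (\<theta> R v) = v" for f v
    by (simp_all add: bij_is_surj surj_f_inv_f bij_is_inj)
  have \<kappa>: "\<kappa> R s = ?c (transvection (simple_root s))" for s
  proof
    fix f
    show "\<kappa> R s f = ?c (transvection (simple_root s)) f"
      using kappa_theta[OF QS, of s "inv_into UNIV (\<theta> R) f"] by (simp add: inv(1))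
  qed
  have comp: "?c v \<circ> ?c w = ?c (v \<circ> w)" for v w by (simp add: fun_eq_iff inv)
  have \<theta>_inv: "\<theta> R \<circ> inv_into UNIV (\<theta> R) = id" by (simp add: fun_eq_iff inv)
  then have c_id: "?c id = id" by simp
  have gens: "carrier ?G \<inter> range (\<kappa> R) = range (\<kappa> R)" using kappa_in_GL[OF R] by auto
  \<comment> \<open>Each move is its own inverse, which reduces the inverse clause of
    \<open>generate\<close> to the generators.\<close>
  have \<kappa>_inv: "inv\<^bsub>?G\<^esub> \<kappa> R s = \<kappa> R s" for s
  proof (rule group.inv_equality[OF G _ kappa_in_GL[OF R] kappa_in_GL[OF R]])
    have "transvection (simple_root s) \<circ> transvection (simple_root s) = id" by auto
    then show "\<kappa> R s \<otimes>\<^bsub>?G\<^esub> \<kappa> R s = \<one>\<^bsub>?G\<^esub>"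
      unfolding \<kappa> by (simp add: GL_def comp \<theta>_inv)
  qed
  have \<kappa>_mem: "\<kappa> R s \<in> ?c ` ?W" for s
    using \<kappa> by (auto intro: transvection_group_gen)
  have "h \<in> ?c ` ?W" if "h \<in> generate ?G (range (\<kappa> R))" for h
    using that
  proof induction
    case one
    have "?c id \<in> ?c ` ?W" by (rule imageI[OF transvection_group.id])
    then show ?case unfolding c_id GL_def by (simp only: monoid.simps)
  next
    case (eng h1 h2)
    then obtain v w where vw: "v \<in> ?W" "w \<in> ?W" "h1 = ?c v" "h2 = ?c w" by blast
    have "?c (v \<circ> w) \<in> ?c ` ?W" by (rule imageI[OF transvection_group_comp[OF vw(1,2)]])
    then show ?case unfolding vw(3,4) GL_def by (simp only: monoid.simps comp)
  next
    case (incl h)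
    then show ?case using \<kappa>_mem by blast
  next
    case (inv h)
    then obtain s where "h = \<kappa> R s" by blast
    then show ?case using \<kappa>_mem[of s] by (simp only: \<kappa>_inv)
  qed
  moreover have "?c w \<in> generate ?G (range (\<kappa> R))" if "w \<in> ?W" for w
    using that
  proof induction
    case id
    have "\<one>\<^bsub>?G\<^esub> = id" by (simp add: GL_def)
    then show ?case unfolding c_id using generate.one[of ?G "range (\<kappa> R)"] by (simp only:)
  next
    case (step x w)
    then obtain s where s: "x = simple_root s" by blast
    have "\<kappa> R s \<otimes>\<^bsub>?G\<^esub> ?c w \<in> generate ?G (range (\<kappa> R))"
      by (rule generate.eng[OF generate.incl[OF rangeI] step.IH])
    moreover have "\<kappa> R s \<otimes>\<^bsub>?G\<^esub> ?c w = ?c (transvection x \<circ> w)"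
      unfolding \<kappa> s GL_def by (simp only: monoid.simps comp)
    ultimately show ?case by (simp only:)
  qed
  ultimately have "generate ?G (range (\<kappa> R)) = ?c ` ?W" by blast
  then show ?thesis
    by (simp add: flipping_group_def subgroup_generated_def gens)
qed

theorem theorem3p1:
  fixes R :: "'s::finite set set"
  assumes "simple_graph (UNIV :: 's set) R"
    and "connected_graph (UNIV :: 's set) R"
    and "nondegenerate_graph R"
    and "\<not> is_line_graph (UNIV :: 's set) R"
  shows "flipping_group R \<cong> orthogonal_group R \<and>
    orbits (flipping_group R) UNIV (\<lambda>h f. h f) =
      {{0}, \<theta> R ` (qform R -` {0} - {0}), \<theta> R ` (qform R -` {1})}"
proof
  have RS: "root_system (bform R) (qform R) (roots R)"
    using assms(1-3) by (rule root_system_graph)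
  interpret root_system "bform R" "qform R" "roots R" by (rule RS)
  have D: "roots R = {v. qform R v = 1}"
    using roots_eq_nonsingular[OF assms(1) RS assms(4)] .
  let ?W = "transvection_group (roots R)"
  let ?c = "\<lambda>w. \<theta> R \<circ> w \<circ> inv_into UNIV (\<theta> R)"
  have O: "carrier (orthogonal_group R) = ?W"
    using carrier_orthogonal_group[OF RS D] .
  have H: "carrier (flipping_group R) = ?c ` ?W"
    using carrier_flipping_group[OF assms(1,3)]
      transvection_group_simple_roots[OF quadratic_space_axioms] by simp
  have bij: "bij (\<theta> R)" using assms(3) by (rule bij_theta)
  then have inv: "\<theta> R (inv_into UNIV (\<theta> R) f) = f" "inv_into UNIV (\<theta> R) (\<theta> R v) = v" for f v
    by (simp_all add: bij_is_surj surj_f_inv_f bij_is_inj)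
  have mult: "g \<otimes>\<^bsub>flipping_group R\<^esub> h = g \<circ> h" "v \<otimes>\<^bsub>orthogonal_group R\<^esub> w = v \<circ> w" for g h v w
    by (simp_all add: flipping_group_def subgroup_generated_def orthogonal_group_def GL_def)
  let ?d = "\<lambda>h. inv_into UNIV (\<theta> R) \<circ> h \<circ> \<theta> R"
  have dc: "?d (?c w) = w" for w by (simp add: fun_eq_iff inv)
  have "?d \<in> iso (flipping_group R) (orthogonal_group R)"
    unfolding iso_def hom_def
  proof (intro CollectI conjI)
    show "bij_betw ?d (carrier (flipping_group R)) (carrier (orthogonal_group R))"
      unfolding O H by (rule bij_betwI[where g = ?c]) (auto simp: dc)
    then show "?d \<in> carrier (flipping_group R) \<rightarrow> carrier (orthogonal_group R)"
      by (auto simp: bij_betw_def)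
    show "\<forall>x\<in>carrier (flipping_group R). \<forall>y\<in>carrier (flipping_group R).
        ?d (x \<otimes>\<^bsub>flipping_group R\<^esub> y) = ?d x \<otimes>\<^bsub>orthogonal_group R\<^esub> ?d y"
      by (simp add: mult fun_eq_iff inv)
  qed
  then show "flipping_group R \<cong> orthogonal_group R" unfolding is_iso_def by blast
  have orb: "orbit (flipping_group R) (\<lambda>h f. h f) (\<theta> R v) = \<theta> R ` {w v | w. w \<in> ?W}" for v
  proof -
    have "orbit (flipping_group R) (\<lambda>h f. h f) (\<theta> R v) = (\<lambda>h. h (\<theta> R v)) ` ?c ` ?W"
      unfolding orbit_def H by blast
    also have "\<dots> = \<theta> R ` (\<lambda>w. w v) ` ?W" by (simp add: image_image inv)
    finally show ?thesis by (simp add: Setcompr_eq_image)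
  qed
  have W_Q: "qform R (w v) = qform R v" if "w \<in> ?W" for w v
    using transvection_group_Q[OF that] root_Q by blast
  have W_0: "w 0 = 0" if "w \<in> ?W" for w
    using transvection_group_add[OF that, of 0 0] by simp
  have W_nz: "w v \<noteq> 0" if "w \<in> ?W" "v \<noteq> 0" for w v
    using W_0[OF that(1)] transvection_group_bij[OF that(1)] that(2) by (metis bij_is_inj injD)
  have o0: "{w 0 | w. w \<in> ?W} = {0}" using W_0 transvection_group.id by force
  have o1: "{w v | w. w \<in> ?W} = qform R -` {1}" if "qform R v = 1" for v
    using that W_Q roots_transitive[of v] D by (auto, metis)
  have o2: "{w v | w. w \<in> ?W} = qform R -` {0} - {0}" if "qform R v = 0" "v \<noteq> 0" for v
    using that W_Q W_nz singular_transitive[of v] D by (auto, metis)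
  have \<theta>0: "\<theta> R ` {0} = {0}" using theta_add[of R 0 0] by simp
  \<comment> \<open>A representative is needed for each of the three sets, since an empty set would
    not be an orbit.\<close>
  obtain v0 where v0: "v0 \<noteq> 0" "qform R v0 = 0"
    using exists_singular[OF assms(1) RS assms(4)] by blast
  have v1: "qform R (simple_root undefined) = 1" by (intro root_Q roots.simple)
  define \<Omega> where "\<Omega> v = \<theta> R ` {w v | w. w \<in> ?W}" for v
  have \<Omega>: "\<Omega> 0 = {0}" "qform R v = 0 \<Longrightarrow> v \<noteq> 0 \<Longrightarrow> \<Omega> v = \<theta> R ` (qform R -` {0} - {0})"
    "qform R v = 1 \<Longrightarrow> \<Omega> v = \<theta> R ` (qform R -` {1})" for v
    unfolding \<Omega>_def using o0 o1[of v] o2[of v] \<theta>0 by simp_all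
  have "orbits (flipping_group R) UNIV (\<lambda>h f. h f) =
      orbit (flipping_group R) (\<lambda>h f. h f) ` range (\<theta> R)"
    unfolding orbits_def bij_is_surj[OF bij] by blast
  also have "\<dots> = range \<Omega>"
    unfolding image_image orb \<Omega>_def ..
  also have "\<dots> = {{0}, \<theta> R ` (qform R -` {0} - {0}), \<theta> R ` (qform R -` {1})}"
  proof (intro equalityI subsetI)
    fix X assume "X \<in> range \<Omega>"
    then obtain v where X: "X = \<Omega> v" by blast
    consider "v = 0" | "qform R v = 0" "v \<noteq> 0" | "qform R v = 1" by (cases "qform R v") auto
    then show "X \<in> {{0}, \<theta> R ` (qform R -` {0} - {0}), \<theta> R ` (qform R -` {1})}"
      using \<Omega> by cases (simp_all add: X)
  next
    fix X assume "X \<in> {{0}, \<theta> R ` (qform R -` {0} - {0}), \<theta> R ` (qform R -` {1})}"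
    then have "X \<in> {\<Omega> 0, \<Omega> v0, \<Omega> (simple_root undefined)}"
      by (simp only: \<Omega>(1) \<Omega>(2)[OF v0(2,1)] \<Omega>(3)[OF v1])
    then show "X \<in> range \<Omega>" by blast
  qed
  finally show "orbits (flipping_group R) UNIV (\<lambda>h f. h f) =
      {{0}, \<theta> R ` (qform R -` {0} - {0}), \<theta> R ` (qform R -` {1})}" .
qed

end
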